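(* For a Banach lattice $E$ the following statements are equivalent. (1) $E$ has the positive Schur property. (2) Every positive disjointly weakly compact operator $T:E\to E$ is $L$-weakly compact.
   Context: Banach lattices are real; $B_E$ is the closed unit ball of $E$. A sequence $(x_n)$ in a Banach lattice is disjoint if $|x_n|\wedge|x_m|=0$ for $n\neq m$. $Sol(A)=\{x: |x|\le |a| \text{ for some } a\in A\}$ is the solid hull of $A$. A norm bounded set $A$ in a Banach lattice is disjointly weakly compact (resp. $L$-weakly compact) if every disjoint sequence in $Sol(A)$ converges to zero weakly (resp. in norm). A bounded linear operator $T$ from a Banach space $X$ to a Banach lattice is disjointly weakly compact (resp. $L$-weakly compact) if $T(B_X)$ is a disjointly weakly compact (resp. $L$-weakly compact) set. A Banach lattice has the positive Schur property if every weakly null sequence with positive terms is norm null (equivalently, every disjoint weakly null sequence is norm null). *)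

theory Defs
  imports "HOL-Analysis.Analysis" "HOL-Library.Lattice_Algebras"
begin

text \<open>
  A (real) Banach lattice: a Banach space that is a vector lattice
  (\<^class>\<open>lattice_ab_group_add_abs\<close> supplies the axiom \<open>\<bar>x\<bar> = sup x (- x)\<close>)
  and whose norm is monotone with respect to the modulus.
\<close>

class banach_lattice = banach + ordered_real_vector + lattice_ab_group_add_abs +
  assumes norm_mono_abs: "\<bar>x\<bar> \<le> \<bar>y\<bar> \<Longrightarrow> norm x \<le> norm y"

definition disjoint_seq :: "(nat \<Rightarrow> 'a::banach_lattice) \<Rightarrow> bool" where
  "disjoint_seq x \<longleftrightarrow> (\<forall>m n. m \<noteq> n \<longrightarrow> inf \<bar>x m\<bar> \<bar>x n\<bar> = 0)"

definition solid_hull :: "'a::banach_lattice set \<Rightarrow> 'a set" where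
  "solid_hull A = {x. \<exists>a\<in>A. \<bar>x\<bar> \<le> \<bar>a\<bar>}"

definition weakly_null :: "(nat \<Rightarrow> 'a::real_normed_vector) \<Rightarrow> bool" where
  "weakly_null x \<longleftrightarrow> (\<forall>f::'a \<Rightarrow> real. bounded_linear f \<longrightarrow> (\<lambda>n. f (x n)) \<longlonglongrightarrow> 0)"

definition disjointly_weakly_compact_set :: "'a::banach_lattice set \<Rightarrow> bool" where
  "disjointly_weakly_compact_set A \<longleftrightarrow>
     bounded A \<and> (\<forall>x. disjoint_seq x \<and> range x \<subseteq> solid_hull A \<longrightarrow> weakly_null x)"

definition L_weakly_compact_set :: "'a::banach_lattice set \<Rightarrow> bool" where
  "L_weakly_compact_set A \<longleftrightarrow>
     bounded A \<and> (\<forall>x. disjoint_seq x \<and> range x \<subseteq> solid_hull A \<longrightarrow> x \<longlonglongrightarrow> 0)"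

definition disjointly_weakly_compact_operator ::
    "('x::banach \<Rightarrow> 'a::banach_lattice) \<Rightarrow> bool" where
  "disjointly_weakly_compact_operator T \<longleftrightarrow>
     bounded_linear T \<and> disjointly_weakly_compact_set (T ` cball 0 1)"

definition L_weakly_compact_operator ::
    "('x::banach \<Rightarrow> 'a::banach_lattice) \<Rightarrow> bool" where
  "L_weakly_compact_operator T \<longleftrightarrow>
     bounded_linear T \<and> L_weakly_compact_set (T ` cball 0 1)"

definition positive_operator ::
    "('a::banach_lattice \<Rightarrow> 'b::banach_lattice) \<Rightarrow> bool" where
  "positive_operator T \<longleftrightarrow> linear T \<and> (\<forall>x. 0 \<le> x \<longrightarrow> 0 \<le> T x)"

text \<open>
  The positive Schur property is a property of the space, hence of the type;
  the argument only serves to fix that type, as in \<open>CARD('a)\<close>.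
\<close>

definition positive_schur_property :: "'a::banach_lattice itself \<Rightarrow> bool" where
  "positive_schur_property _ \<longleftrightarrow>
     (\<forall>x::nat \<Rightarrow> 'a. (\<forall>n. 0 \<le> x n) \<and> weakly_null x \<longrightarrow> x \<longlonglongrightarrow> 0)"

end

theory Submission
  imports Defs
begin

text \<open>
  If the positive Schur property fails, there is a positive weakly null sequence \<open>w\<close> in the unit
  ball that is not norm null, and a disjoint sequence in its solid hull which is not norm null
  either. So it suffices to find a positive disjointly weakly compact operator whose image of the
  unit ball dominates a multiple of every \<open>w n\<close>. If all bounded disjoint sequences are weakly null,
  the identity does this. Otherwise there are a positive functional \<open>h\<close> and a disjoint sequence
  \<open>u\<close> of positive elements of the unit ball with \<open>h (u n)\<close> bounded away from 0; with \<open>g n\<close> the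
  component of \<open>h\<close> on the band generated by \<open>u n\<close>, the operator \<open>x \<mapsto> (\<Sum>n. g n x *\<^sub>R w n)\<close> works: up
  to a uniformly small error every functional sees its image of the unit ball inside an order
  interval, and disjoint sequences in order intervals are weakly null.

  The disjoint sequence below \<open>w\<close> comes from removing from each term of a subsequence large
  multiples of its predecessors. If every \<open>inf (w n) u\<close> tends to 0 in norm, little norm is lost.
  Otherwise \<open>w\<close> may be replaced by an order bounded sequence \<open>inf (w n) u\<close>, and norming functionals
  control the loss: their lower limit is dominated by a single positive functional, which tends
  to 0 along the sequence.
\<close>

subsection \<open>Vector lattice inequalities\<close>

lemma pprt_least: "a \<le> b \<Longrightarrow> 0 \<le> b \<Longrightarrow> pprt a \<le> b" for a b :: "'a::lattice_ab_group_add"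
  by (simp add: pprt_def)

lemma le_pprt: "a \<le> pprt a" for a :: "'a::lattice_ab_group_add"
  by (simp add: pprt_def)

lemma pprt_add_le: "pprt (a + b) \<le> pprt a + pprt b" for a b :: "'a::lattice_ab_group_add"
  by (intro pprt_least add_mono le_pprt add_nonneg_nonneg zero_le_pprt)

lemma pprt_diff_inf: "pprt (a - b) = a - inf a b" for a b :: "'a::lattice_ab_group_add"
  by (simp add: pprt_def add_sup_distrib_left sup_commute)

text \<open>Addition distributes over \<open>inf\<close>, so the right-hand side is the infimum of
  the four sums \<open>a + b\<close>, \<open>a + c\<close>, \<open>c + b\<close> and
  \<open>c + c\<close>, each of which lies above the left-hand side.\<close>

lemma inf_add_le:
  fixes a b c :: "'a::lattice_ab_group_add"
  assumes "0 \<le> a" "0 \<le> b" "0 \<le> c"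
  shows "inf (a + b) c \<le> inf a c + inf b c"
proof -
  have "inf a c + inf b c = inf (inf (a + b) (a + c)) (inf (c + b) (c + c))"
    by (simp add: add_inf_distrib_left add_inf_distrib_right inf_aci)
  moreover have "inf (a + b) c \<le> a + c" "inf (a + b) c \<le> c + b" "inf (a + b) c \<le> c + c"
    by (rule le_infI2, simp add: assms)+
  ultimately show ?thesis
    by simp
qed

text \<open>Both positive parts arise by subtracting \<open>inf a b\<close>, from \<open>a\<close>
  and from \<open>b\<close>, and translations commute with \<open>inf\<close>.\<close>

lemma inf_pprt_diff: "inf (pprt (a - b)) (pprt (b - a)) = 0" for a b :: "'a::lattice_ab_group_add"
proof -
  have "inf (pprt (a - b)) (pprt (b - a)) = inf (a + - inf a b) (b + - inf a b)"
    unfolding pprt_diff_inf inf_commute[of b a] by (simp only: diff_conv_add_uminus)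
  also have "\<dots> = 0"
    unfolding add_inf_distrib_right[symmetric] by (rule right_minus)
  finally show ?thesis .
qed

text \<open>As much of \<open>y\<close> as fits below \<open>a\<close> is \<open>inf y a\<close>;
  the remainder is \<open>pprt (y - a)\<close>, which is below \<open>b\<close> because
  \<open>y - a\<close> is.\<close>

lemma riesz_decomposition:
  fixes y :: "'a::lattice_ab_group_add"
  assumes "0 \<le> y" "y \<le> a + b" "0 \<le> a" "0 \<le> b"
  obtains y1 y2 where "y = y1 + y2" "0 \<le> y1" "y1 \<le> a" "0 \<le> y2" "y2 \<le> b"
proof
  show "y = inf y a + pprt (y - a)"
    unfolding pprt_diff_inf by (simp del: diff_inf_eq_sup)
  show "pprt (y - a) \<le> b"
    using assms by (intro pprt_least) (auto simp: diff_le_eq add.commute)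
qed (use assms in auto)

lemma inf_sum_eq_0:
  fixes a :: "'i \<Rightarrow> 'a::lattice_ab_group_add"
  assumes "finite I" "\<And>i. i \<in> I \<Longrightarrow> 0 \<le> a i" "0 \<le> b" "\<And>i. i \<in> I \<Longrightarrow> inf (a i) b = 0"
  shows "inf (sum a I) b = 0"
  using assms
proof (induction I rule: finite_induct)
  case (insert i I)
  then have "inf (a i + sum a I) b \<le> inf (a i) b + inf (sum a I) b"
    by (intro inf_add_le sum_nonneg) auto
  with insert show ?case
    by (intro antisym) (auto intro!: sum_nonneg add_nonneg_nonneg)
qed (simp add: inf_absorb1)

text \<open>By \<open>a + b = inf a b + sup a b\<close>, sums of disjoint positive elements are
  suprema, so a common upper bound of the terms bounds the sum.\<close>

lemma sum_disjoint_le: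
  fixes a :: "'i \<Rightarrow> 'a::lattice_ab_group_add"
  assumes "finite I" "\<And>i. i \<in> I \<Longrightarrow> 0 \<le> a i" "\<And>i. i \<in> I \<Longrightarrow> a i \<le> x" "0 \<le> x"
    "\<And>i j. i \<in> I \<Longrightarrow> j \<in> I \<Longrightarrow> i \<noteq> j \<Longrightarrow> inf (a i) (a j) = 0"
  shows "sum a I \<le> x"
  using assms
proof (induction I rule: finite_induct)
  case (insert i I)
  have "inf (sum a I) (a i) = 0"
    using insert by (intro inf_sum_eq_0) auto
  then have "a i + sum a I = sup (a i) (sum a I)"
    using add_eq_inf_sup[of "a i" "sum a I"] by (simp add: inf_commute)
  also have "\<dots> \<le> x"
    using insert by auto
  finally show ?case
    using insert by simp
qed simp

section \<open>Scalar multiples and disjointness\<close>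

lemma inf_scaleR:
  fixes a b :: "'a::banach_lattice"
  assumes "0 < c"
  shows "inf (c *\<^sub>R a) (c *\<^sub>R b) = c *\<^sub>R inf a b"
proof (rule antisym)
  have "inverse c *\<^sub>R inf (c *\<^sub>R a) (c *\<^sub>R b) \<le> inf a b"
    using assms by (auto simp: pos_divideR_le_eq)
  then show "inf (c *\<^sub>R a) (c *\<^sub>R b) \<le> c *\<^sub>R inf a b"
    unfolding pos_divideR_le_eq[OF assms] .
qed (use assms in \<open>auto intro!: scaleR_left_mono\<close>)

lemma pprt_scaleR:
  fixes a :: "'a::banach_lattice"
  assumes "0 \<le> c"
  shows "pprt (c *\<^sub>R a) = c *\<^sub>R pprt a"
proof (cases "c = 0")
  case False
  then have "0 < c"
    using assms by simp
  have "- inf (c *\<^sub>R (- a)) (c *\<^sub>R 0) = - (c *\<^sub>R inf (- a) 0)"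
    unfolding inf_scaleR[OF \<open>0 < c\<close>] ..
  then show ?thesis
    unfolding scaleR_minus_right[symmetric] by (simp add: pprt_def)
qed simp

lemma inf_scaleR_eq_0:
  fixes a b :: "'a::banach_lattice"
  assumes "0 \<le> a" "0 \<le> b" "inf a b = 0" "0 \<le> c"
  shows "inf (c *\<^sub>R a) b = 0"
proof (rule antisym)
  \<comment> \<open>A strictly positive number above both \<open>c\<close> and 1, so that
    \<open>inf_scaleR\<close> applies even for \<open>c = 0\<close>.\<close>
  define d where "d = c + 1"
  have d: "0 < d" "c \<le> d" "1 \<le> d"
    using assms by (auto simp: d_def)
  have "inf (c *\<^sub>R a) b \<le> inf (d *\<^sub>R a) (d *\<^sub>R b)"
    using d assms scaleR_right_mono[of 1 d b] by (intro inf_mono scaleR_right_mono) auto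
  then show "inf (c *\<^sub>R a) b \<le> 0"
    using d assms by (simp add: inf_scaleR)
qed (use assms in \<open>auto intro: scaleR_nonneg_nonneg\<close>)

text \<open>The source of disjointness in both constructions below: subtracting suitable multiples
  of two elements from each other makes the positive parts disjoint. For
  \<open>s = inverse t\<close> this is \<open>inf_pprt_diff\<close> after rescaling, and a larger
  \<open>s\<close> only shrinks the first positive part.\<close>

lemma inf_pprt_scaleR_eq_0:
  fixes a b :: "'a::banach_lattice"
  assumes "1 \<le> s * t" "0 < s" "0 < t" "0 \<le> b"
  shows "inf (pprt (a - s *\<^sub>R b)) (pprt (b - t *\<^sub>R a)) = 0"
proof (rule antisym)
  have "pprt (t *\<^sub>R a - b) = t *\<^sub>R pprt (a - inverse t *\<^sub>R b)"
    using assms by (simp add: pprt_scaleR[symmetric] algebra_simps)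
  then have *: "inf (t *\<^sub>R pprt (a - inverse t *\<^sub>R b)) (pprt (b - t *\<^sub>R a)) = 0"
    using inf_pprt_diff[of "t *\<^sub>R a" b] by simp
  have "inf (inverse t *\<^sub>R t *\<^sub>R pprt (a - inverse t *\<^sub>R b)) (pprt (b - t *\<^sub>R a)) = 0"
    using assms by (intro inf_scaleR_eq_0 *) (auto simp del: scaleR_scaleR intro!: scaleR_nonneg_nonneg)
  moreover have "inverse t *\<^sub>R t *\<^sub>R w = w" for w :: 'a
    using assms by simp
  ultimately have "inf (pprt (a - inverse t *\<^sub>R b)) (pprt (b - t *\<^sub>R a)) = 0"
    by simp
  moreover have "inverse t *\<^sub>R b \<le> s *\<^sub>R b"
    using assms by (intro scaleR_right_mono) (auto simp: field_simps)
  then have "pprt (a - s *\<^sub>R b) \<le> pprt (a - inverse t *\<^sub>R b)"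
    by (intro pprt_mono diff_left_mono)
  then have "inf (pprt (a - s *\<^sub>R b)) (pprt (b - t *\<^sub>R a)) \<le>
      inf (pprt (a - inverse t *\<^sub>R b)) (pprt (b - t *\<^sub>R a))"
    by (intro inf_mono order_refl)
  ultimately show "inf (pprt (a - s *\<^sub>R b)) (pprt (b - t *\<^sub>R a)) \<le> 0"
    by simp
qed simp

section \<open>Norm and order; closedness of the positive cone\<close>

lemma norm_mono_nonneg: "0 \<le> a \<Longrightarrow> a \<le> b \<Longrightarrow> norm a \<le> norm b" for a b :: "'a::banach_lattice"
  by (rule norm_mono_abs) (simp add: order_trans)

lemma norm_abs: "norm \<bar>x\<bar> = norm x" for x :: "'a::banach_lattice"
  by (intro antisym norm_mono_abs) simp_all

lemma pprt_le_abs: "pprt x \<le> \<bar>x\<bar>" for x :: "'a::lattice_ab_group_add_abs"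
  by (rule pprt_least) (simp_all add: abs_ge_self)

lemma norm_pprt_le: "norm (pprt x) \<le> norm x" for x :: "'a::banach_lattice"
  using norm_mono_nonneg[of "pprt x" "\<bar>x\<bar>"] by (simp add: norm_abs pprt_le_abs)

text \<open>The negative part of the limit is dominated by \<open>pprt (x n - l)\<close>, whose norm
  is at most the distance from \<open>x n\<close> to \<open>l\<close>.\<close>

lemma LIMSEQ_nonneg:
  fixes x :: "nat \<Rightarrow> 'a::banach_lattice"
  assumes "x \<longlonglongrightarrow> l" "\<And>n. 0 \<le> x n"
  shows "0 \<le> l"
proof -
  have "norm (pprt (- l)) \<le> norm (x n - l)" for n
  proof -
    have "norm (pprt (- l)) \<le> norm (pprt (x n - l))"
      using assms(2)[of n] by (intro norm_mono_nonneg pprt_mono) auto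
    then show ?thesis
      using norm_pprt_le order_trans by blast
  qed
  moreover have "(\<lambda>n. norm (x n - l)) \<longlonglongrightarrow> 0"
    using assms(1) by (simp add: LIM_zero tendsto_norm_zero)
  ultimately have "norm (pprt (- l)) \<le> 0"
    by (meson LIMSEQ_le_const)
  then show ?thesis
    using le_zero_iff_zero_pprt[of "- l"] by simp
qed

lemma LIMSEQ_le_banach_lattice:
  fixes x :: "nat \<Rightarrow> 'a::banach_lattice"
  assumes "x \<longlonglongrightarrow> l" "y \<longlonglongrightarrow> m" "\<And>n. n \<ge> N \<Longrightarrow> x n \<le> y n"
  shows "l \<le> m"
  using LIMSEQ_nonneg[of "\<lambda>n. y (n + N) - x (n + N)" "m - l"] assms
  by (simp add: tendsto_diff LIMSEQ_ignore_initial_segment)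

subsection \<open>The Hahn-Banach theorem\<close>

definition sublinear :: "('a::real_vector \<Rightarrow> real) \<Rightarrow> bool" where
  "sublinear p \<longleftrightarrow> (\<forall>x y. p (x + y) \<le> p x + p y) \<and> (\<forall>c x. 0 \<le> c \<longrightarrow> p (c *\<^sub>R x) = c * p x)"

lemma sublinear_zero: "sublinear p \<Longrightarrow> p 0 = 0"
  unfolding sublinear_def by (metis order_refl mult_zero_left scaleR_zero_left)

lemma sublinear_ge_neg:
  assumes "sublinear p"
  shows "- p (- x) \<le> p x"
proof -
  have "p (x + - x) \<le> p x + p (- x)"
    using assms unfolding sublinear_def by blast
  then show ?thesis
    using sublinear_zero[OF assms] by simp
qed

lemma real_le_cINF_add:
  fixes f :: "'i \<Rightarrow> real" and g :: "'j \<Rightarrow> real"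
  assumes "A \<noteq> {}" "B \<noteq> {}" "\<And>a b. a \<in> A \<Longrightarrow> b \<in> B \<Longrightarrow> c \<le> f a + g b"
  shows "c \<le> (INF a\<in>A. f a) + (INF b\<in>B. g b)"
proof -
  have "c - (INF b\<in>B. g b) \<le> f a" if "a \<in> A" for a
  proof -
    have "c - f a \<le> (INF b\<in>B. g b)"
      using assms that by (intro cINF_greatest) (auto simp: diff_le_eq add.commute)
    then show ?thesis
      by simp
  qed
  then have "c - (INF b\<in>B. g b) \<le> (INF a\<in>A. f a)"
    using assms by (intro cINF_greatest)
  then show ?thesis
    by simp
qed

lemma INF_mult_left_real:
  fixes f :: "'i \<Rightarrow> real"
  assumes "0 < c" "A \<noteq> {}" "bdd_below (f ` A)"
  shows "(INF a\<in>A. c * f a) = c * (INF a\<in>A. f a)"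
proof -
  have "mono ((*) c)"
    using assms by (auto intro!: monoI mult_left_mono)
  from continuous_at_Inf_mono[OF this _ _ assms(3)] assms
  have "c * Inf (f ` A) = Inf ((*) c ` f ` A)"
    by (simp add: continuous_mult_left)
  then show ?thesis
    by (simp only: image_image)
qed

text \<open>Lowering a sublinear function by making it linear along the ray through \<^term>\<open>y\<close>;
  a minimal sublinear function is fixed by all these operations, hence additive.\<close>

lemma sublinear_lower_along:
  fixes p :: "'a::real_vector \<Rightarrow> real" and y :: 'a
  assumes p: "sublinear p"
  defines "q \<equiv> (\<lambda>x. INF t\<in>{0..}. p (x + t *\<^sub>R y) - t * p y)"
  shows "sublinear q" and "q x \<le> p x" and "q x \<le> p (x + y) - p y"
proof -
  have add: "p (a + b) \<le> p a + p b" for a b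
    using p by (auto simp: sublinear_def)
  have hom: "p (c *\<^sub>R x) = c * p x" if "0 \<le> c" for c x
    using p that by (auto simp: sublinear_def)
  \<comment> \<open>Subadditivity gives \<open>t * p y = p (t *\<^sub>R y) <= p (x + t *\<^sub>R y)
    + p (- x)\<close>.\<close>
  have bdd: "bdd_below ((\<lambda>t. p (x + t *\<^sub>R y) - t * p y) ` {0..})" for x
  proof (rule bdd_belowI2)
    fix t :: real assume "t \<in> {0..}"
    then show "- p (- x) \<le> p (x + t *\<^sub>R y) - t * p y"
      using add[of "x + t *\<^sub>R y" "- x"] hom[of t y] by auto
  qed
  have qle: "q x \<le> p (x + t *\<^sub>R y) - t * p y" if "0 \<le> t" for x t
    unfolding q_def using that by (intro cINF_lower bdd) auto
  show "q x \<le> p x" "q x \<le> p (x + y) - p y"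
    using qle[of 0 x] qle[of 1 x] by auto
  show "sublinear q"
    unfolding sublinear_def
  proof (intro conjI allI impI)
    fix a b
    show "q (a + b) \<le> q a + q b"
    proof -
      have "(INF t\<in>{0..}. p (a + b + t *\<^sub>R y) - t * p y) \<le>
          (INF t\<in>{0..}. p (a + t *\<^sub>R y) - t * p y) + (INF t\<in>{0..}. p (b + t *\<^sub>R y) - t * p y)"
      proof (rule real_le_cINF_add)
        fix s t :: real assume st: "s \<in> {0..}" "t \<in> {0..}"
        have "q (a + b) \<le> p ((a + b) + (s + t) *\<^sub>R y) - (s + t) * p y"
          using st by (intro qle) auto
        also have "\<dots> \<le> p (a + s *\<^sub>R y) - s * p y + (p (b + t *\<^sub>R y) - t * p y)"
          using add[of "a + s *\<^sub>R y" "b + t *\<^sub>R y"] by (simp add: algebra_simps)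
        finally show "(INF t\<in>{0..}. p (a + b + t *\<^sub>R y) - t * p y) \<le>
            p (a + s *\<^sub>R y) - s * p y + (p (b + t *\<^sub>R y) - t * p y)"
          by (simp add: q_def)
      qed auto
      then show ?thesis
        by (simp add: q_def)
    qed
  next
    fix c x assume "0 \<le> (c::real)"
    show "q (c *\<^sub>R x) = c * q x"
    proof (cases "c = 0")
      case True
      have "(INF t\<in>{0..}. p (t *\<^sub>R y) - t * p y) = (INF t\<in>{0::real..}. 0::real)"
        by (intro INF_cong) (auto simp: hom)
      with True show ?thesis
        by (simp add: q_def)
    next
      case False
      with \<open>0 \<le> c\<close> have c: "0 < c"
        by simp
      \<comment> \<open>Homogeneity comes from reparametrising the half-line by
        \<open>t = c * t'\<close>, after which \<open>c\<close> can be taken out of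
        \<open>p\<close>.\<close>
      have surj: "times c ` {0..} = {0..}"
      proof (intro equalityI subsetI)
        fix t :: real assume "t \<in> {0..}"
        then show "t \<in> times c ` {0..}"
          using c by (intro image_eqI[of _ _ "t / c"]) auto
      qed (use c in auto)
      have "q (c *\<^sub>R x) = (INF t\<in>(times c ` {0..}). p (c *\<^sub>R x + t *\<^sub>R y) - t * p y)"
        by (simp add: q_def surj)
      also have "\<dots> = (INF t\<in>{0..}. c * (p (x + t *\<^sub>R y) - t * p y))"
      proof -
        have "p (c *\<^sub>R x + (c * t) *\<^sub>R y) - c * t * p y = c * (p (x + t *\<^sub>R y) - t * p y)" for t
          using hom[of c "x + t *\<^sub>R y"] c by (simp add: algebra_simps)
        then show ?thesis
          by (simp add: image_image)
      qed
      also have "\<dots> = c * q x"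
        unfolding q_def by (intro INF_mult_left_real c bdd) auto
      finally show ?thesis .
    qed
  qed
qed

text \<open>Supplies the bounds of chains for Zorn's lemma. The infimum is finite because every
  member is above \<open>- p (- x)\<close> at \<open>x\<close>, and it is subadditive because two
  members of a chain can both be replaced by the smaller one.\<close>

lemma sublinear_chain_INF:
  fixes C :: "('a::real_vector \<Rightarrow> real) set"
  assumes "C \<noteq> {}" and sub: "\<And>q. q \<in> C \<Longrightarrow> sublinear q \<and> q \<le> p"
    and chain: "\<And>q r. q \<in> C \<Longrightarrow> r \<in> C \<Longrightarrow> q \<le> r \<or> r \<le> q"
  shows "sublinear (\<lambda>x. INF q\<in>C. q x)" and "r \<in> C \<Longrightarrow> (\<lambda>x. INF q\<in>C. q x) \<le> r"
proof -
  have bdd: "bdd_below ((\<lambda>q. q x) ` C)" for x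
  proof (rule bdd_belowI2)
    fix q assume "q \<in> C"
    then show "- p (- x) \<le> q x"
      using sub[of q] sublinear_ge_neg[of q x] by (meson le_funD neg_le_iff_le order_trans)
  qed
  have le: "(INF q\<in>C. q x) \<le> r x" if "r \<in> C" for x r
    using that by (intro cINF_lower bdd)
  then show "r \<in> C \<Longrightarrow> (\<lambda>x. INF q\<in>C. q x) \<le> r"
    by (auto simp: le_fun_def)
  show "sublinear (\<lambda>x. INF q\<in>C. q x)"
    unfolding sublinear_def
  proof (intro conjI allI impI)
    fix a b
    show "(INF q\<in>C. q (a + b)) \<le> (INF q\<in>C. q a) + (INF q\<in>C. q b)"
    proof (rule real_le_cINF_add)
      fix q r assume "q \<in> C" "r \<in> C"
      then obtain s where s: "s \<in> C" "s \<le> q" "s \<le> r"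
        using chain by blast
      have "s (a + b) \<le> s a + s b"
        using sub[OF s(1)] by (auto simp: sublinear_def)
      then show "(INF q\<in>C. q (a + b)) \<le> q a + r b"
        using le[OF s(1), of "a + b"] le_funD[OF s(2), of a] le_funD[OF s(3), of b] by linarith
    qed (use assms in auto)
  next
    fix c x assume "0 \<le> (c::real)"
    then have "(INF q\<in>C. q (c *\<^sub>R x)) = (INF q\<in>C. c * q x)"
      using sub by (intro INF_cong) (auto simp: sublinear_def)
    also have "\<dots> = c * (INF q\<in>C. q x)"
      using INF_mult_left_real[of c C "\<lambda>q. q x"] \<open>0 \<le> c\<close> assms(1) bdd by (cases "c = 0") auto
    finally show "(INF q\<in>C. q (c *\<^sub>R x)) = c * (INF q\<in>C. q x)" .
  qed
qed

text \<open>Zorn's lemma for the reversed order gives a minimal sublinear \<open>m\<close> below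
  \<open>p\<close>. Minimality makes it additive, hence odd, and positive homogeneity then extends
  to all scalars.\<close>

theorem hahn_banach_sublinear:
  fixes p :: "'a::real_vector \<Rightarrow> real"
  assumes "sublinear p"
  obtains f where "linear f" "\<And>x. f x \<le> p x"
proof -
  define A where "A = {q. sublinear q \<and> q \<le> p}"
  have "\<exists>m\<in>A. \<forall>a\<in>A. a \<le> m \<longrightarrow> a = m"
  proof (rule predicate_Zorn)
    show "partial_order_on A (relation_of (\<lambda>q r. r \<le> q) A)"
      by (auto simp: partial_order_on_def preorder_on_def refl_on_def trans_def antisym_def relation_of_def)
  next
    fix C assume "C \<in> Chains (relation_of (\<lambda>q r. r \<le> q) A)"
    then have C: "C \<subseteq> A" "\<And>q r. q \<in> C \<Longrightarrow> r \<in> C \<Longrightarrow> q \<le> r \<or> r \<le> q"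
      by (auto simp: Chains_def relation_of_def)
    show "\<exists>u\<in>A. \<forall>a\<in>C. u \<le> a"
    \<comment> \<open>The infimum over an empty chain carries no information; in that case
      \<open>p\<close> itself is the bound.\<close>
    proof (cases "C = {}")
      case False
      have sub: "sublinear q \<and> q \<le> p" if "q \<in> C" for q
        using C(1) that by (auto simp: A_def)
      let ?u = "\<lambda>x. INF q\<in>C. q x"
      have "sublinear ?u" "\<And>r. r \<in> C \<Longrightarrow> ?u \<le> r"
        using sublinear_chain_INF[OF False sub C(2)] by auto
      moreover from this False sub have "?u \<le> p"
        by (meson all_not_in_conv order_trans)
      ultimately show ?thesis
        by (intro bexI[of _ ?u]) (auto simp: A_def)
    qed (use assms in \<open>auto simp: A_def\<close>)
  qed
  then obtain m where m: "sublinear m" "m \<le> p"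
    and min: "\<And>a. sublinear a \<Longrightarrow> a \<le> m \<Longrightarrow> a = m"
    by (auto simp: A_def intro: order_trans)
  have add: "m (x + y) = m x + m y" for x y
  proof (rule antisym)
    \<comment> \<open>Lowering \<open>m\<close> along \<open>y\<close> changes nothing, by
      minimality, so the bound \<open>q x <= m (x + y) - m y\<close> is the missing
      superadditivity.\<close>
    define q where "q = (\<lambda>x. INF t\<in>{0..}. m (x + t *\<^sub>R y) - t * m y)"
    have "q = m"
      using sublinear_lower_along(1,2)[OF m(1), where y = y] by (intro min) (auto simp: q_def le_fun_def)
    then show "m x + m y \<le> m (x + y)"
      using sublinear_lower_along(3)[OF m(1), where y = y and x = x] by (auto simp: q_def fun_eq_iff)
  qed (use m in \<open>auto simp: sublinear_def\<close>)
  have neg: "m (- x) = - m x" for x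
    using add[of x "- x"] sublinear_zero[OF m(1)] by simp
  have "linear m"
  proof (rule linearI)
    fix c :: real and x
    show "m (c *\<^sub>R x) = c *\<^sub>R m x"
    proof (cases "0 \<le> c")
      case False
      then have "m ((- c) *\<^sub>R x) = (- c) * m x"
        using m(1) unfolding sublinear_def by (metis less_imp_le neg_0_le_iff_le not_le)
      then show ?thesis
        using neg[of "c *\<^sub>R x"] by simp
    qed (use m in \<open>auto simp: sublinear_def\<close>)
  qed (rule add)
  then show thesis
    using that m(2) by (auto simp: le_fun_def)
qed

text \<open>Lowering \<open>p\<close> along \<open>a\<close> before applying Hahn-Banach forces
  \<open>f (- a) <= p 0 - p a\<close>, that is, \<open>p a <= f a\<close>.\<close>

corollary hahn_banach_norming:
  fixes p :: "'a::real_vector \<Rightarrow> real"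
  assumes "sublinear p"
  obtains f where "linear f" "\<And>x. f x \<le> p x" "f a = p a"
proof -
  note q = sublinear_lower_along[OF assms, where y = a]
  obtain f where f: "linear f" "\<And>x. f x \<le> (INF t\<in>{0..}. p (x + t *\<^sub>R a) - t * p a)"
    using hahn_banach_sublinear[OF q(1)] by blast
  have le: "f x \<le> p x" for x
    using f(2) q(2) order_trans by blast
  moreover have "f (- a) \<le> - p a"
    using order_trans[OF f(2)[of "- a"] q(3)[of "- a"]] sublinear_zero[OF assms] by simp
  then have "f a = p a"
    using le[of a] linear_neg[OF f(1), of a] by simp
  ultimately show thesis
    using that f(1) by blast
qed

subsection \<open>Positive functionals\<close>

definition positive_functional :: "('a::banach_lattice \<Rightarrow> real) \<Rightarrow> bool" where
  "positive_functional f \<longleftrightarrow> bounded_linear f \<and> (\<forall>x. 0 \<le> x \<longrightarrow> 0 \<le> f x)"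

lemma positive_functional_mono:
  assumes "positive_functional f" "x \<le> y"
  shows "f x \<le> f y"
proof -
  interpret bounded_linear f
    using assms by (simp add: positive_functional_def)
  have "0 \<le> f (y - x)"
    using assms by (simp add: positive_functional_def)
  then show ?thesis
    by (simp add: diff)
qed

text \<open>A bound by the norm of the positive part yields both properties: at \<open>- x\<close>
  with \<open>0 <= x\<close> the positive part vanishes, which gives positivity, and
  \<open>norm (pprt x) <= norm x\<close> gives boundedness.\<close>

lemma positive_functionalI:
  fixes f :: "'a::banach_lattice \<Rightarrow> real"
  assumes "linear f" "\<And>x. f x \<le> K * norm (pprt x)" "0 \<le> K"
  shows "positive_functional f" and "\<bar>f x\<bar> \<le> K * norm x"
proof -
  have le: "f x \<le> K * norm x" for x
    using mult_left_mono[OF norm_pprt_le[of x] \<open>0 \<le> K\<close>] assms(2)[of x] by simp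
  have abs: "\<bar>f x\<bar> \<le> K * norm x" for x
    using le[of x] le[of "- x"] linear_neg[OF \<open>linear f\<close>, of x] by (simp add: abs_le_iff)
  then show "\<bar>f x\<bar> \<le> K * norm x" .
  have "bounded_linear f"
    using assms(1) abs
    by (intro bounded_linear_intro[where K = K]) (auto simp: linear_add linear_scale mult.commute)
  moreover have "0 \<le> f x" if "0 \<le> x" for x
    using that assms(2)[of "- x"] linear_neg[OF \<open>linear f\<close>, of x] by simp
  ultimately show "positive_functional f"
    by (simp add: positive_functional_def)
qed

text \<open>Hahn-Banach is applied to the norm of the positive part instead of the norm, so that the
  norming functional comes out positive.\<close>

lemma positive_functional_norming:
  fixes a :: "'a::banach_lattice"
  assumes "0 \<le> a"
  obtains f where "positive_functional f" "f a = norm a" "\<And>x. \<bar>f x\<bar> \<le> norm x"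
proof -
  let ?p = "\<lambda>x::'a. norm (pprt x)"
  have "sublinear ?p"
    unfolding sublinear_def
  proof (intro conjI allI impI)
    fix x y :: 'a
    have "norm (pprt (x + y)) \<le> norm (pprt x + pprt y)"
      by (intro norm_mono_nonneg pprt_add_le) simp
    then show "norm (pprt (x + y)) \<le> norm (pprt x) + norm (pprt y)"
      using norm_triangle_ineq order_trans by blast
  qed (simp add: pprt_scaleR)
  then obtain f where f: "linear f" "\<And>x. f x \<le> ?p x" "f a = ?p a"
    using hahn_banach_norming by blast
  then show thesis
    using positive_functionalI[OF f(1), of 1] assms by (intro that[of f]) auto
qed

text \<open>A positive functional above the pointwise lower limit of the \<^term>\<open>f m\<close>: a substitute
  for a weak* cluster point.\<close>

lemma positive_functional_ge_liminf:
  fixes f :: "'i \<Rightarrow> 'a::banach_lattice \<Rightarrow> real"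
  assumes f: "\<And>m. positive_functional (f m)" and bound: "\<And>m x. \<bar>f m x\<bar> \<le> norm x"
    and F: "F \<noteq> bot"
  obtains g where "positive_functional g" "\<And>x c. eventually (\<lambda>m. c \<le> f m x) F \<Longrightarrow> c \<le> g x"
proof -
  have lin: "linear (f m)" for m
    using f[of m] by (simp add: positive_functional_def bounded_linear.linear)
  \<comment> \<open>\<open>S x\<close> collects the eventual upper bounds of \<open>f m x\<close>,
    so \<open>p\<close> is the upper limit along \<open>F\<close>. A linear \<open>g\<close> below
    \<open>p\<close> is above the lower limit: an eventual lower bound \<open>c\<close> at
    \<open>x\<close> is an eventual upper bound \<open>- c\<close> at \<open>- x\<close>.\<close>
  define S where "S x = {c. eventually (\<lambda>m. f m x \<le> c) F}" for x
  define p where "p x = Inf (S x)" for x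
  have bdd: "bdd_below (S x)" for x
  proof (rule bdd_belowI)
    fix c assume "c \<in> S x"
    then obtain m where "f m x \<le> c"
      using eventually_happens'[OF F] by (auto simp: S_def)
    then show "- norm x \<le> c"
      using bound[of m x] by linarith
  qed
  have pprt: "norm (pprt x) \<in> S x" for x
  proof -
    have "f m x \<le> norm (pprt x)" for m
      using positive_functional_mono[OF f le_pprt, of m x] bound[of m "pprt x"] by linarith
    then show ?thesis
      by (simp add: S_def)
  qed
  have ple: "p x \<le> c" if "c \<in> S x" for x c
    unfolding p_def using that bdd by (rule cInf_lower)
  have "sublinear p"
    unfolding sublinear_def
  proof (intro conjI allI impI)
    fix x y :: 'a
    have "p (x + y) \<le> (INF c\<in>S x. c) + (INF c\<in>S y. c)"
    proof (rule real_le_cINF_add)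
      fix a b assume "a \<in> S x" "b \<in> S y"
      then have "eventually (\<lambda>m. f m (x + y) \<le> a + b) F"
        unfolding S_def mem_Collect_eq
        by eventually_elim (simp add: linear_add[OF lin])
      then show "p (x + y) \<le> a + b"
        by (intro ple) (simp add: S_def)
    qed (use pprt in blast)+
    then show "p (x + y) \<le> p x + p y"
      by (simp add: p_def)
  next
    fix c :: real and x assume "0 \<le> c"
    show "p (c *\<^sub>R x) = c * p x"
    proof (cases "c = 0")
      case True
      have "S 0 = {0..}"
        using F by (auto simp: S_def linear_0[OF lin])
      with True show ?thesis
        by (simp add: p_def)
    next
      case False
      with \<open>0 \<le> c\<close> have c: "0 < c"
        by simp
      have "S (c *\<^sub>R x) = times c ` S x"
      proof (intro equalityI subsetI)
        fix t assume "t \<in> S (c *\<^sub>R x)"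
        then have "t / c \<in> S x"
          using c by (simp add: S_def linear_scale[OF lin] field_simps)
        then show "t \<in> times c ` S x"
          using c by (intro image_eqI[of _ _ "t / c"]) auto
      qed (use c in \<open>auto simp: S_def linear_scale[OF lin]\<close>)
      moreover have "(INF t\<in>S x. c * t) = c * (INF t\<in>S x. t)"
        using INF_mult_left_real[OF c, of "S x" "\<lambda>t. t"] bdd pprt by auto
      ultimately show ?thesis
        by (simp add: p_def)
    qed
  qed
  then obtain g where g: "linear g" "\<And>x. g x \<le> p x"
    using hahn_banach_sublinear by blast
  have "g x \<le> 1 * norm (pprt x)" for x
    using g(2)[of x] ple[OF pprt, of x] by simp
  then have "positive_functional g"
    using positive_functionalI(1)[OF g(1), of 1] by simp
  moreover have "c \<le> g x" if "eventually (\<lambda>m. c \<le> f m x) F" for x c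
  proof -
    have "p (- x) \<le> - c"
      using that by (intro ple) (simp add: S_def linear_neg[OF lin])
    then show ?thesis
      using g(2)[of "- x"] linear_neg[OF g(1), of x] by simp
  qed
  ultimately show thesis
    using that by blast
qed

text \<open>Kantorovich's extension through \<open>x = pprt x - pprt (- x)\<close>. Additivity on
  the cone makes the value independent of how an element is written as a difference of positive
  ones, and linearity follows.\<close>

lemma positive_functional_cone_extension:
  fixes \<phi> :: "'a::banach_lattice \<Rightarrow> real"
  assumes add: "\<And>x y. 0 \<le> x \<Longrightarrow> 0 \<le> y \<Longrightarrow> \<phi> (x + y) = \<phi> x + \<phi> y"
    and scale: "\<And>c x. 0 < c \<Longrightarrow> 0 \<le> x \<Longrightarrow> \<phi> (c *\<^sub>R x) = c * \<phi> x"
    and nonneg: "\<And>x. 0 \<le> x \<Longrightarrow> 0 \<le> \<phi> x"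
    and bound: "\<And>x. 0 \<le> x \<Longrightarrow> \<phi> x \<le> K * norm x" and "0 \<le> K"
  obtains g where "positive_functional g" "\<And>x. 0 \<le> x \<Longrightarrow> g x = \<phi> x"
proof -
  define g where "g x = \<phi> (pprt x) - \<phi> (pprt (- x))" for x :: 'a
  have prt: "x = pprt x - pprt (- x)" for x :: 'a
    using prts[of x] by (simp add: pprt_neg)
  have g: "g (a - b) = \<phi> a - \<phi> b" if "0 \<le> a" "0 \<le> b" for a b
  proof -
    have "pprt (a - b) + b = a + pprt (- (a - b))"
      using prt[of "a - b"] by (simp add: algebra_simps)
    then have "\<phi> (pprt (a - b)) + \<phi> b = \<phi> a + \<phi> (pprt (- (a - b)))"
      using add[of "pprt (a - b)" b] add[of a "pprt (- (a - b))"] that by simp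
    then show ?thesis
      by (simp add: g_def)
  qed
  have \<phi>0: "\<phi> 0 = 0"
    using add[of 0 0] by simp
  have neg: "g (- x) = - g x" for x
    by (simp add: g_def)
  have "linear g"
  proof (rule linearI)
    fix x y :: 'a
    have "x + y = (pprt x + pprt y) - (pprt (- x) + pprt (- y))"
      by (subst prt[of x], subst prt[of y]) (simp add: algebra_simps)
    then have "g (x + y) = \<phi> (pprt x + pprt y) - \<phi> (pprt (- x) + pprt (- y))"
      using g[of "pprt x + pprt y" "pprt (- x) + pprt (- y)"] by (simp add: add_nonneg_nonneg)
    then show "g (x + y) = g x + g y"
      by (simp add: add g_def)
  next
    have pos: "g (c *\<^sub>R x) = c * g x" if "0 < c" for c x
      using that pprt_scaleR[of c x] pprt_scaleR[of c "- x"]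
      by (simp add: g_def scale right_diff_distrib)
    fix c :: real and x
    consider "0 < c" | "c = 0" | "0 < - c"
      by linarith
    then show "g (c *\<^sub>R x) = c *\<^sub>R g x"
    proof cases
      case 3
      then show ?thesis
        using pos[OF 3, of x] neg[of "c *\<^sub>R x"] by simp
    qed (simp_all add: pos, simp add: g_def \<phi>0)
  qed
  moreover have "g x \<le> K * norm (pprt x)" for x
    using nonneg[of "pprt (- x)"] bound[of "pprt x"] by (simp add: g_def)
  ultimately have "positive_functional g"
    using positive_functionalI(1) \<open>0 \<le> K\<close> by blast
  moreover have "g x = \<phi> x" if "0 \<le> x" for x
    using that by (simp add: g_def \<phi>0)
  ultimately show thesis
    using that by blast
qed

text \<open>For \<^term>\<open>I = UNIV\<close> this is the positive part of \<^term>\<open>f\<close>, for a band \<^term>\<open>I\<close> its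
  component on \<^term>\<open>I\<close>.\<close>

lemma positive_functional_component:
  fixes f :: "'a::banach_lattice \<Rightarrow> real"
  assumes f: "bounded_linear f"
    and I: "0 \<in> I" "\<And>x y. x \<in> I \<Longrightarrow> y \<in> I \<Longrightarrow> x + y \<in> I" "\<And>c x. 0 < c \<Longrightarrow> x \<in> I \<Longrightarrow> c *\<^sub>R x \<in> I"
      "\<And>x y. y \<in> I \<Longrightarrow> 0 \<le> x \<Longrightarrow> x \<le> y \<Longrightarrow> x \<in> I"
  obtains g where "positive_functional g"
    "\<And>x y. y \<in> I \<Longrightarrow> 0 \<le> y \<Longrightarrow> y \<le> x \<Longrightarrow> f y \<le> g x"
    "\<And>x c. 0 \<le> x \<Longrightarrow> (\<And>y. y \<in> I \<Longrightarrow> 0 \<le> y \<Longrightarrow> y \<le> x \<Longrightarrow> f y \<le> c) \<Longrightarrow> g x \<le> c"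
proof -
  interpret f: bounded_linear f
    by (rule f)
  obtain K where K: "0 < K" "\<And>x. norm (f x) \<le> norm x * K"
    using f.pos_bounded by blast
  \<comment> \<open>The Riesz-Kantorovich formula: \<open>\<phi> x\<close> is the supremum of
    \<open>f\<close> over the positive elements of \<open>I\<close> below \<open>x\<close>. It is
    additive by Riesz decomposition, whose parts stay in \<open>I\<close> because \<open>I\<close>
    is closed under passing to smaller positive elements.\<close>
  define S where "S x = {y \<in> I. 0 \<le> y \<and> y \<le> x}" for x
  define \<phi> where "\<phi> x = (SUP y\<in>S x. f y)" for x
  have le: "f y \<le> K * norm x" if "y \<in> S x" for x y
  proof -
    have "norm y * K \<le> norm x * K"
      using that K by (intro mult_right_mono norm_mono_nonneg) (auto simp: S_def)
    then show ?thesis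
      using K(2)[of y] by (simp add: mult.commute)
  qed
  have ub: "f y \<le> \<phi> x" if "y \<in> S x" for x y
    unfolding \<phi>_def using that le by (intro cSUP_upper bdd_aboveI2)
  have ne: "0 \<in> S x" if "0 \<le> x" for x
    using that I by (simp add: S_def)
  have lub: "\<phi> x \<le> c" if "0 \<le> x" "\<And>y. y \<in> S x \<Longrightarrow> f y \<le> c" for x c
    unfolding \<phi>_def using ne that by (intro cSUP_least) auto
  obtain g where g: "positive_functional g" "\<And>x. 0 \<le> x \<Longrightarrow> g x = \<phi> x"
  proof (rule positive_functional_cone_extension[of \<phi> K])
    fix x y :: 'a assume xy: "0 \<le> x" "0 \<le> y"
    show "\<phi> (x + y) = \<phi> x + \<phi> y"
    proof (rule antisym)
      show "\<phi> (x + y) \<le> \<phi> x + \<phi> y"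
      proof (rule lub)
        fix z assume z: "z \<in> S (x + y)"
        then have "0 \<le> z" "z \<le> x + y"
          by (auto simp: S_def)
        then obtain z1 z2 where z12: "z = z1 + z2" "0 \<le> z1" "z1 \<le> x" "0 \<le> z2" "z2 \<le> y"
          using riesz_decomposition xy by blast
        then have "z1 \<le> z" "z2 \<le> z"
          by auto
        then have "z1 \<in> S x" "z2 \<in> S y"
          using z z12 I(4)[of z z1] I(4)[of z z2] by (auto simp: S_def)
        then show "f z \<le> \<phi> x + \<phi> y"
          using ub[of z1 x] ub[of z2 y] by (simp add: z12 f.add)
      qed (use xy in simp)
      have "\<phi> x \<le> \<phi> (x + y) - \<phi> y"
      proof (rule lub)
        fix a assume a: "a \<in> S x"
        have "\<phi> y \<le> \<phi> (x + y) - f a"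
        proof (rule lub)
          fix b assume b: "b \<in> S y"
          have "a + b \<in> S (x + y)"
            using a b I by (auto simp: S_def intro: add_mono)
          then show "f b \<le> \<phi> (x + y) - f a"
            using ub[of "a + b" "x + y"] by (simp add: f.add)
        qed (rule xy)
        then show "f a \<le> \<phi> (x + y) - \<phi> y"
          by simp
      qed (rule xy)
      then show "\<phi> x + \<phi> y \<le> \<phi> (x + y)"
        by simp
    qed
  next
    \<comment> \<open>One inequality suffices: applied to \<open>inverse c\<close> and
      \<open>c *\<^sub>R x\<close> it gives the other.\<close>
    have ge: "c * \<phi> x \<le> \<phi> (c *\<^sub>R x)" if "0 < c" "0 \<le> x" for c x
    proof -
      have "\<phi> x \<le> \<phi> (c *\<^sub>R x) / c"
      proof (rule lub)
        fix y assume "y \<in> S x"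
        then have "c *\<^sub>R y \<in> S (c *\<^sub>R x)"
          using that I by (auto simp: S_def intro!: scaleR_left_mono scaleR_nonneg_nonneg)
        then show "f y \<le> \<phi> (c *\<^sub>R x) / c"
          using ub[of "c *\<^sub>R y" "c *\<^sub>R x"] that by (simp add: f.scaleR field_simps)
      qed (rule that)
      then show ?thesis
        using that by (simp add: field_simps)
    qed
    fix c :: real and x :: 'a assume "0 < c" "0 \<le> x"
    then show "\<phi> (c *\<^sub>R x) = c * \<phi> x"
      using ge[of c x] ge[of "inverse c" "c *\<^sub>R x"] scaleR_nonneg_nonneg[of c x]
      by (intro antisym) (auto simp: field_simps)
  next
    fix x :: 'a assume x: "0 \<le> x"
    show "0 \<le> \<phi> x"
      using ub[OF ne[OF x]] by (simp add: f.zero)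
    show "\<phi> x \<le> K * norm x"
      using lub[OF x] le by blast
  qed (use K in auto)
  have "f y \<le> g x" if "y \<in> I" "0 \<le> y" "y \<le> x" for x y
    using ub[of y x] g(2)[of x] that by (auto simp: S_def)
  moreover have "g x \<le> c" if "0 \<le> x" "\<And>y. y \<in> I \<Longrightarrow> 0 \<le> y \<Longrightarrow> y \<le> x \<Longrightarrow> f y \<le> c" for x c
    using lub[of x c] g(2)[of x] that by (auto simp: S_def)
  ultimately show thesis
    using that g(1) by blast
qed

text \<open>The dominating functional is the sum of the positive parts of \<open>f\<close> and of
  \<open>- f\<close>, that is, the modulus of \<open>f\<close> in the dual.\<close>

lemma positive_functional_dominating:
  fixes f :: "'a::banach_lattice \<Rightarrow> real"
  assumes "bounded_linear f"
  obtains g where "positive_functional g" "\<And>x. \<bar>f x\<bar> \<le> g \<bar>x\<bar>"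
proof -
  obtain h where h: "positive_functional h" "\<And>x y. 0 \<le> y \<Longrightarrow> y \<le> x \<Longrightarrow> f y \<le> h x"
    by (rule positive_functional_component[OF assms, of UNIV]) auto
  obtain k where k: "positive_functional k" "\<And>x y. 0 \<le> y \<Longrightarrow> y \<le> x \<Longrightarrow> - f y \<le> k x"
    by (rule positive_functional_component[OF bounded_linear_minus[OF assms], of UNIV]) auto
  interpret f: bounded_linear f by fact
  show thesis
  proof
    show "positive_functional (\<lambda>x. h x + k x)"
      using h(1) k(1) by (auto simp: positive_functional_def intro!: bounded_linear_add)
    fix x :: 'a
    have *: "f x = f (pprt x) - f (pprt (- x))"
      by (simp add: f.diff[symmetric] pprt_neg prts[symmetric])
    have "pprt x \<le> \<bar>x\<bar>" "pprt (- x) \<le> \<bar>x\<bar>"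
      using pprt_le_abs[of x] pprt_le_abs[of "- x"] by auto
    then show "\<bar>f x\<bar> \<le> h \<bar>x\<bar> + k \<bar>x\<bar>"
      unfolding * using h(2)[of "pprt x" "\<bar>x\<bar>"] h(2)[of "pprt (- x)" "\<bar>x\<bar>"]
        k(2)[of "pprt x" "\<bar>x\<bar>"] k(2)[of "pprt (- x)" "\<bar>x\<bar>"]
      by (auto simp: abs_le_iff)
  qed
qed

text \<open>A functional is dominated by a positive one evaluated at the modulus, so positive
  functionals suffice as tests, and what they show for the moduli passes to the sequence
  itself.\<close>

lemma weakly_null_iff_positive:
  fixes x :: "nat \<Rightarrow> 'a::banach_lattice"
  shows "weakly_null (\<lambda>n. \<bar>x n\<bar>) \<longleftrightarrow> (\<forall>f. positive_functional f \<longrightarrow> (\<lambda>n. f \<bar>x n\<bar>) \<longlonglongrightarrow> 0)"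
    and "weakly_null (\<lambda>n. \<bar>x n\<bar>) \<Longrightarrow> weakly_null x"
proof -
  have dom: "(\<lambda>n. f (y n)) \<longlonglongrightarrow> 0"
    if f: "bounded_linear f" and y: "\<And>n. \<bar>y n\<bar> = \<bar>x n\<bar>"
      and *: "\<forall>g. positive_functional g \<longrightarrow> (\<lambda>n. g \<bar>x n\<bar>) \<longlonglongrightarrow> 0"
    for f :: "'a \<Rightarrow> real" and y
  proof -
    obtain g where g: "positive_functional g" "\<And>x. \<bar>f x\<bar> \<le> g \<bar>x\<bar>"
      using positive_functional_dominating[OF f] by blast
    show ?thesis
      using * g(1) by (rule_tac Lim_null_comparison[of _ "\<lambda>n. g \<bar>x n\<bar>"]) (auto simp: y[symmetric] g(2))
  qed
  show iff: "weakly_null (\<lambda>n. \<bar>x n\<bar>) \<longleftrightarrow> (\<forall>f. positive_functional f \<longrightarrow> (\<lambda>n. f \<bar>x n\<bar>) \<longlonglongrightarrow> 0)"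
    using dom[of _ "\<lambda>n. \<bar>x n\<bar>"] by (auto simp: weakly_null_def positive_functional_def)
  show "weakly_null (\<lambda>n. \<bar>x n\<bar>) \<Longrightarrow> weakly_null x"
    using dom[of _ x] unfolding iff by (auto simp: weakly_null_def)
qed

subsection \<open>Disjoint sequences below a weakly null sequence\<close>

lemma not_LIMSEQ_zero_subseq:
  fixes x :: "nat \<Rightarrow> 'a::real_normed_vector"
  assumes "\<not> x \<longlonglongrightarrow> 0"
  obtains r :: "nat \<Rightarrow> nat" and e where "strict_mono r" "0 < e" "\<And>n. e \<le> norm (x (r n))"
proof -
  have "\<exists>e>0. \<forall>N. \<exists>n\<ge>N. e \<le> norm (x n)"
    using assms by (simp add: LIMSEQ_iff not_less)
  then obtain e where e: "0 < e" "\<forall>N. \<exists>n\<ge>N. e \<le> norm (x n)"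
    by blast
  then have "infinite {n. e \<le> norm (x n)}"
    by (simp add: infinite_nat_iff_unbounded_le)
  from infinite_enumerate[OF this]
  obtain r :: "nat \<Rightarrow> nat" where "strict_mono r" "\<forall>n. r n \<in> {n. e \<le> norm (x n)}"
    by blast
  then show thesis
    using e(1) by (intro that[of r e]) auto
qed

text \<open>Otherwise, for each \<open>n\<close> in \<open>M\<close>, \<open>f m (z n)\<close> is at
  least \<open>d\<close> for almost all \<open>m\<close> in \<open>M\<close>. A positive functional
  above the lower limit along \<open>M\<close> is then at least \<open>d\<close> at all these
  \<open>z n\<close>, although it tends to 0 along \<open>z\<close>.\<close>

lemma functionals_small_infinitely_often:
  fixes f :: "nat \<Rightarrow> 'a::banach_lattice \<Rightarrow> real"
  assumes f: "\<And>m. positive_functional (f m)" "\<And>m x. \<bar>f m x\<bar> \<le> norm x"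
    and z: "\<And>g. positive_functional g \<Longrightarrow> (\<lambda>n. g (z n)) \<longlonglongrightarrow> 0"
    and "infinite M" "0 < d"
  shows "\<exists>n\<in>M. infinite {m \<in> M. f m (z n) < d}"
proof (rule ccontr)
  assume "\<not> ?thesis"
  then have fin: "finite {m \<in> M. f m (z n) < d}" if "n \<in> M" for n
    using that by blast
  \<comment> \<open>Eventually along \<open>F\<close> means for all but finitely many elements of
    \<open>M\<close>.\<close>
  define F where "F = inf cofinite (principal M)"
  have "F \<noteq> bot"
    using \<open>infinite M\<close> by (auto simp: F_def trivial_limit_def eventually_inf_principal eventually_cofinite)
  then obtain g where g: "positive_functional g"
    "\<And>x c. eventually (\<lambda>m. c \<le> f m x) F \<Longrightarrow> c \<le> g x"
    using positive_functional_ge_liminf[of f F] f by blast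
  have ge: "d \<le> g (z n)" if "n \<in> M" for n
    using fin[OF that]
    by (intro g(2)) (simp add: F_def eventually_inf_principal eventually_cofinite not_le)
  have "eventually (\<lambda>n. g (z n) < d) sequentially"
    using order_tendstoD(2)[OF z[OF g(1)] \<open>0 < d\<close>] .
  then obtain N where "\<And>n. N \<le> n \<Longrightarrow> g (z n) < d"
    unfolding eventually_sequentially by blast
  moreover obtain n where "N \<le> n" "n \<in> M"
    using \<open>infinite M\<close> unfolding infinite_nat_iff_unbounded_le by blast
  ultimately show False
    using ge[of n] by fastforce
qed

lemma functionals_small_subseq:
  fixes f :: "nat \<Rightarrow> 'a::banach_lattice \<Rightarrow> real"
  assumes f: "\<And>m. positive_functional (f m)" "\<And>m x. \<bar>f m x\<bar> \<le> norm x"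
    and z: "\<And>g. positive_functional g \<Longrightarrow> (\<lambda>n. g (z n)) \<longlonglongrightarrow> 0"
    and d: "\<And>k. 0 < d k"
  obtains r :: "nat \<Rightarrow> nat" where "\<And>i j. j < i \<Longrightarrow> f (r i) (z (r j)) < d j"
proof -
  \<comment> \<open>A state is an index already chosen together with an infinite set of candidates
    for all later indices; every candidate's functional is small at the chosen term. By
    \<open>Q\<close>, the next index is a candidate and the candidate sets shrink.\<close>
  define P where "P k s \<longleftrightarrow> infinite (snd s) \<and> (\<forall>m\<in>snd s. f m (z (fst s)) < d k)"
    for k and s :: "nat \<times> nat set"
  define Q where "Q s t \<longleftrightarrow> fst t \<in> snd s \<and> snd t \<subseteq> snd s" for s t :: "nat \<times> nat set"
  have step: "\<exists>t. P k t \<and> fst t \<in> M \<and> snd t \<subseteq> M" if M: "infinite M" for k M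
  proof -
    obtain n where "n \<in> M" "infinite {m \<in> M. f m (z n) < d k}"
      using functionals_small_infinitely_often[of f z M "d k"] f z M d by blast
    then show ?thesis
      by (intro exI[of _ "(n, {m \<in> M. f m (z n) < d k})"]) (auto simp: P_def)
  qed
  have "\<exists>s. \<forall>k. P k (s k) \<and> Q (s k) (s (Suc k))"
  proof (rule dependent_nat_choice)
    show "\<exists>s. P 0 s"
      using step[of UNIV 0] by auto
    show "\<exists>t. P (Suc k) t \<and> Q s t" if "P k s" for s k
      using step[of "snd s" "Suc k"] that by (auto simp: P_def Q_def)
  qed
  then obtain s where s: "\<And>k. P k (s k)" "\<And>k. Q (s k) (s (Suc k))"
    by blast
  have anti: "snd (s j) \<subseteq> snd (s i)" if "i \<le> j" for i j
    by (rule lift_Suc_antimono_le[of "\<lambda>k. snd (s k)"]) (use s(2) that in \<open>auto simp: Q_def\<close>)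
  have "f (fst (s i)) (z (fst (s j))) < d j" if ji: "j < i" for i j
  proof -
    obtain k where k: "i = Suc k" "j \<le> k"
      using ji by (cases i) auto
    then have "fst (s i) \<in> snd (s j)"
      using s(2)[of k] anti[OF k(2)] by (auto simp: Q_def)
    then show ?thesis
      using s(1)[of j] by (auto simp: P_def)
  qed
  then show thesis
    by (rule that)
qed

text \<open>From \<open>g i\<close> one removes large multiples of its predecessors and a small
  multiple of \<open>u\<close>. The second removal takes care of all later terms at once, since they
  lie below \<open>u\<close>. The functional norming \<open>g i\<close> loses at most
  \<open>e / 4\<close> in each removal, because it is small at the predecessors.\<close>

lemma disjoint_below_order_bounded:
  fixes z :: "nat \<Rightarrow> 'a::banach_lattice"
  assumes z: "\<And>n. 0 \<le> z n" "\<And>n. z n \<le> u"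
    and null: "\<And>g. positive_functional g \<Longrightarrow> (\<lambda>n. g (z n)) \<longlonglongrightarrow> 0"
    and e: "0 < e" "\<And>n. e \<le> norm (z n)"
  obtains y :: "nat \<Rightarrow> 'a" where "\<And>i. 0 \<le> y i" "\<And>i. \<exists>n. y i \<le> z n" "\<And>i j. i \<noteq> j \<Longrightarrow> inf (y i) (y j) = 0"
    "\<And>i. e / 2 \<le> norm (y i)"
proof -
  have "\<exists>f. positive_functional f \<and> f (z n) = norm (z n) \<and> (\<forall>x. \<bar>f x\<bar> \<le> norm x)" for n
    using positive_functional_norming[OF z(1)[of n]] by blast
  then obtain f where f: "\<And>n. positive_functional (f n)" "\<And>n. f n (z n) = norm (z n)"
    "\<And>n x. \<bar>f n x\<bar> \<le> norm x"
    by metis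
  \<comment> \<open>\<open>K\<close> is chosen with \<open>norm u / K <= e / 4\<close>, the added 1
    keeping it positive when \<open>u = 0\<close>. The product \<open>C j * d j\<close> is
    \<open>e / 8 * (1 / 2) ^ j\<close>, so the losses at the predecessors sum to at most
    \<open>e / 4\<close>.\<close>
  define K where "K = 4 * norm u / e + 1"
  define C where "C j = K * 2 ^ j" for j :: nat
  define d where "d j = e / (8 * K * 4 ^ j)" for j :: nat
  have K: "1 \<le> K" "norm u / K \<le> e / 4"
  proof -
    show "1 \<le> K"
      using e(1) by (simp add: K_def)
    have "norm u \<le> e / 4 * K"
      using e(1) by (simp add: K_def field_simps)
    then show "norm u / K \<le> e / 4"
      using \<open>1 \<le> K\<close> by (simp add: pos_divide_le_eq)
  qed
  have C: "0 < C j" for j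
    using K by (simp add: C_def)
  obtain r where r: "\<And>i j. j < i \<Longrightarrow> f (r i) (z (r j)) < d j"
    using functionals_small_subseq[of f z d] f null K e by (auto simp: d_def)
  define g where "g i = z (r i)" for i
  define y where "y i = pprt (g i - (\<Sum>j<i. C j *\<^sub>R g j) - inverse (C i) *\<^sub>R u)" for i
  have g: "0 \<le> g i" "g i \<le> u" for i
    using z by (auto simp: g_def)
  have u: "0 \<le> u"
    using g[of 0] by (rule order_trans)
  have sum_nonneg': "0 \<le> (\<Sum>j\<in>A. C j *\<^sub>R g j)" for A
    using C g by (intro sum_nonneg scaleR_nonneg_nonneg) (auto intro: less_imp_le)
  have y_le: "y i \<le> g i" for i
  proof -
    have "0 \<le> (\<Sum>j<i. C j *\<^sub>R g j) + inverse (C i) *\<^sub>R u"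
      using u C[of i] by (intro add_nonneg_nonneg sum_nonneg' scaleR_nonneg_nonneg) auto
    then show ?thesis
      unfolding y_def diff_diff_eq using g by (intro pprt_least) (simp_all only: diff_le_eq le_add_same_cancel1)
  qed
  have disj: "inf (y i) (y n) = 0" if "i < n" for i n
  proof (rule antisym)
    \<comment> \<open>Since \<open>g n <= u\<close>, removing the multiple of \<open>u\<close> from
      the earlier term removes at least that multiple of \<open>g n\<close>. The later term loses
      \<open>C i\<close> times \<open>g i\<close>, and the two coefficients have product 1.\<close>
    have "y i \<le> pprt (g i - inverse (C i) *\<^sub>R g n)"
      unfolding y_def using sum_nonneg'[of "{..<i}"] C[of i] g[of n]
      by (intro pprt_mono diff_mono) (auto intro!: scaleR_left_mono)
    moreover have "C i *\<^sub>R g i \<le> (\<Sum>j<n. C j *\<^sub>R g j)"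
      using that C g sum_mono2[of "{..<n}" "{i}" "\<lambda>j. C j *\<^sub>R g j"]
      by (auto intro!: scaleR_nonneg_nonneg intro: less_imp_le)
    then have "C i *\<^sub>R g i \<le> (\<Sum>j<n. C j *\<^sub>R g j) + inverse (C n) *\<^sub>R u"
      using u C[of n] by (intro add_increasing2) (auto intro!: scaleR_nonneg_nonneg)
    then have "y n \<le> pprt (g n - C i *\<^sub>R g i)"
      unfolding y_def diff_diff_eq by (intro pprt_mono diff_mono) auto
    ultimately have "inf (y i) (y n) \<le> inf (pprt (g i - inverse (C i) *\<^sub>R g n)) (pprt (g n - C i *\<^sub>R g i))"
      by (rule inf_mono)
    also have "\<dots> = 0"
      using C[of i] g by (intro inf_pprt_scaleR_eq_0) auto
    finally show "inf (y i) (y n) \<le> 0" .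
  qed (simp add: y_def)
  have norm_y: "e / 2 \<le> norm (y i)" for i
  proof -
    interpret f: bounded_linear "f (r i)"
      using f(1) by (simp add: positive_functional_def)
    have "(\<Sum>j<i. C j * f (r i) (g j)) \<le> (\<Sum>j<i. e / 8 * (1 / 2) ^ j)"
    proof (rule sum_mono)
      fix j assume "j \<in> {..<i}"
      then have "C j * f (r i) (g j) \<le> C j * d j"
        using r[of j i] C[of j] by (intro mult_left_mono) (auto simp: g_def less_imp_le)
      also have "C j * d j = e / 8 * (1 / 2) ^ j"
        using K(1) by (simp add: C_def d_def field_simps power_mult_distrib[symmetric])
      finally show "C j * f (r i) (g j) \<le> e / 8 * (1 / 2) ^ j" .
    qed
    also have "\<dots> = e / 8 * (\<Sum>j<i. (1 / 2) ^ j)"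
      by (simp add: sum_distrib_left)
    also have "\<dots> \<le> e / 8 * 2"
      using e(1) by (intro mult_left_mono) (auto simp: sum_gp_strict)
    finally have 1: "(\<Sum>j<i. C j * f (r i) (g j)) \<le> e / 4"
      by simp
    have "f (r i) u \<le> norm u"
      using f(3)[of "r i" u] by simp
    then have "inverse (C i) * f (r i) u \<le> inverse (C i) * norm u"
      using C[of i] by (intro mult_left_mono) auto
    also have "\<dots> \<le> inverse K * norm u"
      using K(1) by (intro mult_right_mono) (auto simp: C_def field_simps)
    also have "\<dots> \<le> e / 4"
      using K(2) by (simp add: field_simps)
    finally have 2: "inverse (C i) * f (r i) u \<le> e / 4" .
    have "e / 2 \<le> f (r i) (g i) - (\<Sum>j<i. C j * f (r i) (g j)) - inverse (C i) * f (r i) u"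
      using 1 2 f(2)[of "r i"] e(2)[of "r i"] by (simp add: g_def)
    also have "\<dots> = f (r i) (g i - (\<Sum>j<i. C j *\<^sub>R g j) - inverse (C i) *\<^sub>R u)"
      by (simp only: f.diff f.sum f.scaleR real_scaleR_def)
    also have "\<dots> \<le> f (r i) (y i)"
      unfolding y_def by (intro positive_functional_mono f le_pprt)
    also have "\<dots> \<le> norm (y i)"
      using f(3)[of "r i" "y i"] by simp
    finally show ?thesis .
  qed
  show thesis
  proof (rule that[of y])
    show "inf (y i) (y j) = 0" if "i \<noteq> j" for i j
      using disj[of i j] disj[of j i] that by (cases "i < j") (auto simp: inf_commute)
    show "\<exists>n. y i \<le> z n" for i
      using y_le[of i] by (auto simp: g_def)
  qed (use norm_y in \<open>auto simp: y_def\<close>)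
qed

section \<open>Sequences whose truncations tend to 0 in norm\<close>

lemma le_suminf_banach_lattice:
  fixes a :: "nat \<Rightarrow> 'a::banach_lattice"
  assumes "summable a" "\<And>n. 0 \<le> a n" "finite I"
  shows "sum a I \<le> suminf a"
proof (rule LIMSEQ_le_banach_lattice)
  show "(\<lambda>n. sum a {..<n}) \<longlonglongrightarrow> suminf a"
    using assms(1) by (rule summable_LIMSEQ)
  \<comment> \<open>Inserting 0 keeps \<open>Max\<close> meaningful for empty
    \<open>I\<close>.\<close>
  show "sum a I \<le> sum a {..<n}" if "n \<ge> Suc (Max (insert 0 I))" for n
    using assms that by (intro sum_mono2) (auto simp: Suc_le_eq)
qed (rule tendsto_const)

text \<open>Each term is chosen nearly disjoint from a large multiple of the sum of its
  predecessors, so removing that multiple costs little norm. The weighted sum \<open>x\<close> of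
  all chosen terms replaces the order bound of the previous case: a small multiple of it dominates a
  positive multiple of each later term.\<close>

lemma disjoint_below_locally_null:
  fixes z :: "nat \<Rightarrow> 'a::banach_lattice"
  assumes z: "\<And>n. 0 \<le> z n" "\<And>n. norm (z n) \<le> 1"
    and null: "\<And>u. 0 \<le> u \<Longrightarrow> (\<lambda>n. inf (z n) u) \<longlonglongrightarrow> 0"
    and e: "0 < e" "\<And>n. e \<le> norm (z n)"
  obtains y :: "nat \<Rightarrow> 'a" where "\<And>i. 0 \<le> y i" "\<And>i. \<exists>n. y i \<le> z n" "\<And>i j. i \<noteq> j \<Longrightarrow> inf (y i) (y j) = 0"
    "\<not> y \<longlonglongrightarrow> 0"
proof -
  have step: "\<exists>n. norm (inf (z n) (4 ^ Suc k *\<^sub>R s)) \<le> (1 / 2) ^ Suc k" if "0 \<le> s" for k s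
  proof -
    have "0 \<le> 4 ^ Suc k *\<^sub>R s"
      using that by (intro scaleR_nonneg_nonneg) auto
    then have "(\<lambda>n. norm (inf (z n) (4 ^ Suc k *\<^sub>R s))) \<longlonglongrightarrow> 0"
      by (intro tendsto_norm_zero null)
    then have "eventually (\<lambda>n. norm (inf (z n) (4 ^ Suc k *\<^sub>R s)) < (1 / 2) ^ Suc k) sequentially"
      by (rule order_tendstoD) simp
    then show ?thesis
      by (auto simp: eventually_sequentially intro: less_imp_le)
  qed
  \<comment> \<open>A state pairs the last chosen index with the sum of all terms chosen so
    far.\<close>
  define Q where "Q k a b \<longleftrightarrow> snd b = snd a + z (fst b) \<and>
      norm (inf (z (fst b)) (4 ^ Suc k *\<^sub>R snd a)) \<le> (1 / 2) ^ Suc k" for k and a b :: "nat \<times> 'a"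
  have "\<exists>s. \<forall>k. (0 \<le> snd (s k) \<and> (k = 0 \<longrightarrow> snd (s k) = z (fst (s k)))) \<and> Q k (s k) (s (Suc k))"
  proof (rule dependent_nat_choice)
    show "\<exists>a. 0 \<le> snd a \<and> (0 = (0::nat) \<longrightarrow> snd a = z (fst a))"
      using z by (intro exI[of _ "(0, z 0)"]) auto
    show "\<exists>b. (0 \<le> snd b \<and> (Suc k = 0 \<longrightarrow> snd b = z (fst b))) \<and> Q k a b"
      if a: "0 \<le> snd a \<and> (k = 0 \<longrightarrow> snd a = z (fst a))" for a k
    proof -
      obtain n where "norm (inf (z n) (4 ^ Suc k *\<^sub>R snd a)) \<le> (1 / 2) ^ Suc k"
        using step[of "snd a" k] a by blast
      then show ?thesis
        using a z by (intro exI[of _ "(n, snd a + z n)"]) (auto simp: Q_def)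
    qed
  qed
  then obtain p where p: "\<And>k. 0 \<le> snd (p k)" "snd (p 0) = z (fst (p 0))" "\<And>k. Q k (p k) (p (Suc k))"
    by blast
  define g where "g k = z (fst (p k))" for k
  have snd_p: "snd (p k) = (\<Sum>j\<le>k. g j)" for k
    by (induction k) (use p in \<open>auto simp: g_def Q_def\<close>)
  have small: "norm (inf (g (Suc k)) (4 ^ Suc k *\<^sub>R (\<Sum>j\<le>k. g j))) \<le> (1 / 2) ^ Suc k" for k
    using p(3)[of k] unfolding snd_p[symmetric] by (simp only: Q_def g_def)
  have g: "0 \<le> g k" "norm (g k) \<le> 1" "e \<le> norm (g k)" for k
    using z e by (auto simp: g_def)
  have summ: "summable (\<lambda>j. (1 / 2) ^ j *\<^sub>R g j)"
    by (rule summable_comparison_test'[of "\<lambda>j. (1 / 2) ^ j" 0]) (use g(2) in \<open>auto simp: mult_left_le\<close>)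
  define x where "x = (\<Sum>j. (1 / 2) ^ j *\<^sub>R g j)"
  have "0 \<le> (1 / 2) ^ j *\<^sub>R g j" for j
    using g(1) by (intro scaleR_nonneg_nonneg) auto
  then have le_x: "(1 / 2) ^ j *\<^sub>R g j \<le> x" for j
    using le_suminf_banach_lattice[OF summ, of "{j}"] by (simp add: x_def)
  have x: "0 \<le> x"
    using le_x[of 0] g(1)[of 0] by simp
  define b where "b i = 4 ^ Suc i *\<^sub>R (\<Sum>j\<le>i. g j)" for i
  define c where "c i = (1 / 2) ^ Suc i *\<^sub>R x" for i
  have b: "0 \<le> b i" and c: "0 \<le> c i" for i
    using g(1) x by (auto simp: b_def c_def intro!: scaleR_nonneg_nonneg sum_nonneg)
  \<comment> \<open>The index is shifted because \<open>b i\<close> contains the terms up to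
    \<open>g i\<close>, which are the predecessors of \<open>g (Suc i)\<close>.\<close>
  define y where "y i = pprt (g (Suc i) - (b i + c i))" for i
  have y_le: "y i \<le> g (Suc i)" for i
    unfolding y_def using g add_nonneg_nonneg[OF b c]
    by (intro pprt_least) (simp_all only: diff_le_eq le_add_same_cancel1)
  have disj: "inf (y i) (y n) = 0" if "i < n" for i n
  proof (rule antisym)
    have "((1 / 2) ^ Suc i * (1 / 2) ^ Suc n) *\<^sub>R g (Suc n) \<le> c i"
      unfolding c_def scaleR_scaleR[symmetric] by (intro scaleR_left_mono le_x) simp
    then have "y i \<le> pprt (g (Suc i) - ((1 / 2) ^ Suc i * (1 / 2) ^ Suc n) *\<^sub>R g (Suc n))"
      unfolding y_def using b[of i] by (intro pprt_mono diff_left_mono) (rule add_increasing)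
    moreover have "g (Suc i) \<le> (\<Sum>j\<le>n. g j)"
      using that g(1) sum_mono2[of "{..n}" "{Suc i}" g] by auto
    then have "4 ^ Suc n *\<^sub>R g (Suc i) \<le> b n"
      unfolding b_def by (intro scaleR_left_mono) auto
    then have "y n \<le> pprt (g (Suc n) - 4 ^ Suc n *\<^sub>R g (Suc i))"
      unfolding y_def using c[of n] by (intro pprt_mono diff_left_mono) (rule add_increasing2)
    ultimately have "inf (y i) (y n) \<le>
        inf (pprt (g (Suc i) - ((1 / 2) ^ Suc i * (1 / 2) ^ Suc n) *\<^sub>R g (Suc n)))
          (pprt (g (Suc n) - 4 ^ Suc n *\<^sub>R g (Suc i)))"
      by (rule inf_mono)
    also have "\<dots> = 0"
    proof (rule inf_pprt_scaleR_eq_0)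
      \<comment> \<open>This is why the predecessors carry powers of 4: one factor
        \<open>2 ^ Suc n\<close> offsets the weight of \<open>g (Suc n)\<close> in \<open>x\<close>,
        the other the coefficient \<open>(1 / 2) ^ Suc i\<close> of \<open>x\<close> in
        \<open>c i\<close>.\<close>
      have "(2::real) ^ Suc i * 2 ^ Suc n \<le> 2 ^ Suc n * 2 ^ Suc n"
        using that by (intro mult_right_mono power_increasing) auto
      also have "\<dots> = 4 ^ Suc n"
        by (simp only: power_mult_distrib[symmetric]) simp
      finally show "1 \<le> (1 / 2) ^ Suc i * (1 / 2) ^ Suc n * (4::real) ^ Suc n"
        by (simp add: field_simps)
    qed (use g in auto)
    finally show "inf (y i) (y n) \<le> 0" .
  qed (simp add: y_def)
  have "\<not> y \<longlonglongrightarrow> 0"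
  proof
    assume "y \<longlonglongrightarrow> 0"
    moreover have "(\<lambda>i. (1 / 2) ^ Suc i * (1 + norm x)) \<longlonglongrightarrow> 0"
      by (intro tendsto_mult_left_zero LIMSEQ_Suc LIMSEQ_power_zero) simp
    ultimately have lim: "(\<lambda>i. norm (y i) + (1 / 2) ^ Suc i * (1 + norm x)) \<longlonglongrightarrow> 0"
      by (intro tendsto_add_zero tendsto_norm_zero)
    have "e \<le> norm (y i) + (1 / 2) ^ Suc i * (1 + norm x)" for i
    proof -
      \<comment> \<open>Only the part of \<open>b i\<close> that meets \<open>g (Suc i)\<close> is
        really lost, namely \<open>inf (g (Suc i)) (b i)\<close>, and it is small by the choice of
        the terms.\<close>
      have "pprt (g (Suc i) - b i) \<le> y i + c i"
        unfolding y_def using c[of i] le_pprt[of "g (Suc i) - (b i + c i)"]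
        by (intro pprt_least) (auto simp: algebra_simps intro: add_nonneg_nonneg)
      then have "g (Suc i) \<le> y i + (c i + inf (g (Suc i)) (b i))"
        unfolding pprt_diff_inf by (simp add: algebra_simps del: diff_inf_eq_sup)
      then have "norm (g (Suc i)) \<le> norm (y i + (c i + inf (g (Suc i)) (b i)))"
        by (rule norm_mono_nonneg[OF g(1)])
      also have "\<dots> \<le> norm (y i) + (norm (c i) + norm (inf (g (Suc i)) (b i)))"
        by (intro norm_triangle_le add_left_mono norm_triangle_ineq)
      also have "\<dots> \<le> norm (y i) + ((1 / 2) ^ Suc i * norm x + (1 / 2) ^ Suc i)"
        using small[of i] by (intro add_left_mono add_mono) (simp_all add: c_def b_def)
      finally show ?thesis
        using g(3)[of "Suc i"] by (simp add: distrib_left)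
    qed
    then have "e \<le> 0"
      using LIMSEQ_le_const[OF lim] by blast
    then show False
      using e(1) by simp
  qed
  show thesis
  proof (rule that[of y])
    show "inf (y i) (y j) = 0" if "i \<noteq> j" for i j
      using disj[of i j] disj[of j i] that by (cases "i < j") (auto simp: inf_commute)
    show "\<exists>n. y i \<le> z n" for i
      using y_le[of i] by (auto simp: g_def)
  qed (use \<open>\<not> y \<longlonglongrightarrow> 0\<close> in \<open>auto simp: y_def\<close>)
qed

text \<open>Either all truncations of \<open>z\<close> by a fixed element are norm null, or some
  truncated subsequence stays away from 0. In the latter case it is order bounded and still null
  against positive functionals, being below \<open>z\<close>.\<close>

lemma disjoint_below_weakly_null:
  fixes z :: "nat \<Rightarrow> 'a::banach_lattice"
  assumes z: "\<And>n. 0 \<le> z n" "\<And>n. norm (z n) \<le> 1"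
    and null: "\<And>g. positive_functional g \<Longrightarrow> (\<lambda>n. g (z n)) \<longlonglongrightarrow> 0"
    and "\<not> z \<longlonglongrightarrow> 0"
  obtains y :: "nat \<Rightarrow> 'a" where "\<And>i. 0 \<le> y i" "\<And>i. \<exists>n. y i \<le> z n" "\<And>i j. i \<noteq> j \<Longrightarrow> inf (y i) (y j) = 0"
    "\<not> y \<longlonglongrightarrow> 0"
proof (cases "\<exists>u\<ge>0. \<not> (\<lambda>n. inf (z n) u) \<longlonglongrightarrow> 0")
  case True
  then obtain u where u: "0 \<le> u" "\<not> (\<lambda>n. inf (z n) u) \<longlonglongrightarrow> 0"
    by blast
  obtain r :: "nat \<Rightarrow> nat" and e where r: "strict_mono r" "0 < e" "\<And>n. e \<le> norm (inf (z (r n)) u)"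
    using not_LIMSEQ_zero_subseq[OF u(2)] by metis
  have "(\<lambda>n. g (inf (z (r n)) u)) \<longlonglongrightarrow> 0" if g: "positive_functional g" for g :: "'a \<Rightarrow> real"
  proof (rule tendsto_sandwich[of "\<lambda>_. 0"])
    show "(\<lambda>n. g (z (r n))) \<longlonglongrightarrow> 0"
      using LIMSEQ_subseq_LIMSEQ[OF null[OF g] r(1)] by (simp add: o_def)
    show "eventually (\<lambda>n. 0 \<le> g (inf (z (r n)) u)) sequentially"
      using g z u by (simp add: positive_functional_def)
    show "eventually (\<lambda>n. g (inf (z (r n)) u) \<le> g (z (r n))) sequentially"
      by (simp add: positive_functional_mono[OF g])
  qed simp
  moreover have "0 \<le> inf (z (r n)) u" "inf (z (r n)) u \<le> u" for n
    using z u by auto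
  ultimately obtain y :: "nat \<Rightarrow> 'a" where y: "\<And>i. 0 \<le> y i" "\<And>i. \<exists>n. y i \<le> inf (z (r n)) u"
    "\<And>i j. i \<noteq> j \<Longrightarrow> inf (y i) (y j) = 0" "\<And>i. e / 2 \<le> norm (y i)"
    using disjoint_below_order_bounded[of "\<lambda>n. inf (z (r n)) u" u e] r(2,3) by blast
  have "\<not> y \<longlonglongrightarrow> 0"
  proof
    assume "y \<longlonglongrightarrow> 0"
    then have "e / 2 \<le> 0"
      using LIMSEQ_le_const[OF tendsto_norm_zero, of y "e / 2"] y(4) by blast
    then show False
      using r(2) by simp
  qed
  moreover have "\<exists>n. y i \<le> z n" for i
    using y(2)[of i] by auto
  ultimately show thesis
    using that[of y] y by blast
next
  case False
  obtain r :: "nat \<Rightarrow> nat" and e where r: "strict_mono r" "0 < e" "\<And>n. e \<le> norm (z (r n))"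
    using not_LIMSEQ_zero_subseq[OF assms(4)] by metis
  have "(\<lambda>n. inf (z (r n)) u) \<longlonglongrightarrow> 0" if "0 \<le> u" for u
    using LIMSEQ_subseq_LIMSEQ[of "\<lambda>n. inf (z n) u" 0 r] False that r(1) by (auto simp: o_def)
  from disjoint_below_locally_null[of "\<lambda>n. z (r n)", OF z(1) z(2) this r(2,3)]
  obtain y :: "nat \<Rightarrow> 'a" where "\<And>i. 0 \<le> y i" "\<And>i. \<exists>n. y i \<le> z (r n)" "\<And>i j. i \<noteq> j \<Longrightarrow> inf (y i) (y j) = 0"
    "\<not> y \<longlonglongrightarrow> 0"
    by blast
  then show thesis
    using that[of y] by blast
qed

subsection \<open>Operators factoring through the space of summable sequences\<close>

text \<open>The components of \<open>h\<close> on the bands generated by the \<open>u n\<close>.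
  Elements of different bands are disjoint, so elements of the bands below \<open>x\<close> have
  their sum below \<open>x\<close>, and the components add up to at most \<open>h\<close>.\<close>

lemma band_components:
  fixes u :: "nat \<Rightarrow> 'a::banach_lattice"
  assumes h: "positive_functional h"
    and u: "\<And>n. 0 \<le> u n" "\<And>m n. m \<noteq> n \<Longrightarrow> inf (u m) (u n) = 0"
  obtains g where "\<And>n. positive_functional (g n)" "\<And>n. h (u n) \<le> g n (u n)"
    "\<And>N x. 0 \<le> x \<Longrightarrow> (\<Sum>n<N. g n x) \<le> h x"
proof -
  interpret h: bounded_linear h
    using h by (simp add: positive_functional_def)
  \<comment> \<open>The positive cone of the band generated by \<open>u n\<close>, written as the
    second disjoint complement.\<close>
  define I where "I n = {y. 0 \<le> y \<and> (\<forall>w\<ge>0. inf w (u n) = 0 \<longrightarrow> inf w y = 0)}" for n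
  have "\<exists>g. positive_functional g \<and> (\<forall>x y. y \<in> I n \<longrightarrow> y \<le> x \<longrightarrow> h y \<le> g x) \<and>
      (\<forall>x c. 0 \<le> x \<longrightarrow> (\<forall>y. y \<in> I n \<longrightarrow> y \<le> x \<longrightarrow> h y \<le> c) \<longrightarrow> g x \<le> c)" for n
  proof (rule positive_functional_component[OF h.bounded_linear_axioms, of "I n"])
    show "0 \<in> I n"
      by (simp add: I_def inf_absorb2)
    show "x + y \<in> I n" if "x \<in> I n" "y \<in> I n" for x y
    proof -
      have "inf w (x + y) = 0" if w: "0 \<le> w" "inf w (u n) = 0" for w
      proof (rule antisym)
        have "inf w (x + y) \<le> inf x w + inf y w"
          using inf_add_le[of x y w] w \<open>x \<in> I n\<close> \<open>y \<in> I n\<close> by (simp add: I_def inf_commute)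
        also have "\<dots> = 0"
          using w \<open>x \<in> I n\<close> \<open>y \<in> I n\<close> by (simp add: I_def inf_commute)
        finally show "inf w (x + y) \<le> 0" .
      qed (use w \<open>x \<in> I n\<close> \<open>y \<in> I n\<close> in \<open>simp add: I_def\<close>)
      then show ?thesis
        using that by (simp add: I_def)
    qed
    show "c *\<^sub>R x \<in> I n" if "0 < c" "x \<in> I n" for c x
      using that inf_scaleR_eq_0[of x _ c] by (auto simp: I_def inf_commute intro: scaleR_nonneg_nonneg)
    show "x \<in> I n" if "y \<in> I n" "0 \<le> x" "x \<le> y" for x y
    proof -
      have "inf w x = 0" if w: "0 \<le> w" "inf w (u n) = 0" for w
      proof (rule antisym)
        have "inf w x \<le> inf w y"
          using \<open>x \<le> y\<close> by (intro inf_mono order_refl)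
        also have "\<dots> = 0"
          using w \<open>y \<in> I n\<close> by (simp add: I_def)
        finally show "inf w x \<le> 0" .
      qed (use w \<open>0 \<le> x\<close> in simp)
      then show ?thesis
        using that by (simp add: I_def)
    qed
  next
    fix g assume g: "positive_functional g"
      "\<And>x y. y \<in> I n \<Longrightarrow> 0 \<le> y \<Longrightarrow> y \<le> x \<Longrightarrow> h y \<le> g x"
      "\<And>x c. 0 \<le> x \<Longrightarrow> (\<And>y. y \<in> I n \<Longrightarrow> 0 \<le> y \<Longrightarrow> y \<le> x \<Longrightarrow> h y \<le> c) \<Longrightarrow> g x \<le> c"
    show ?thesis
    proof (intro exI[of _ g] conjI allI impI)
      show "h y \<le> g x" if "y \<in> I n" "y \<le> x" for x y
        using g(2) that by (simp add: I_def)
      show "g x \<le> c" if "0 \<le> x" "\<forall>y. y \<in> I n \<longrightarrow> y \<le> x \<longrightarrow> h y \<le> c" for x c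
        using g(3) that by blast
    qed (rule g(1))
  qed
  then obtain g where g: "\<And>n. positive_functional (g n)"
    "\<And>n x y. y \<in> I n \<Longrightarrow> y \<le> x \<Longrightarrow> h y \<le> g n x"
    "\<And>n x c. 0 \<le> x \<Longrightarrow> (\<forall>y. y \<in> I n \<longrightarrow> y \<le> x \<longrightarrow> h y \<le> c) \<Longrightarrow> g n x \<le> c"
    by metis
  \<comment> \<open>The definition of the band is used twice: \<open>u n\<close>, disjoint from
    \<open>u m\<close>, is disjoint from \<open>y\<close>; hence \<open>y\<close>, disjoint from
    \<open>u n\<close>, is disjoint from \<open>y'\<close>.\<close>
  have disj: "inf y y' = 0" if "y \<in> I m" "y' \<in> I n" "m \<noteq> n" for y y' m n
  proof -
    have "inf (u n) y = 0"
      using that u by (simp add: I_def)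
    then have "inf y (u n) = 0"
      by (simp add: inf_commute)
    then show ?thesis
      using that by (simp add: I_def)
  qed
  have sum_le: "(\<Sum>n<N. g n x) \<le> h x" if x: "0 \<le> x" for N x
  proof (rule field_le_epsilon)
    fix e :: real assume e: "0 < e"
    \<comment> \<open>The tolerance for each of \<open>N\<close> near-maximisers, so that the total
      error is at most \<open>e\<close>; \<open>Suc\<close> avoids division by 0.\<close>
    define d where "d = e / Suc N"
    have "0 < d"
      using e by (simp add: d_def)
    have "\<exists>y. y \<in> I n \<and> y \<le> x \<and> g n x - d < h y" for n
      using g(3)[OF x, of n "g n x - d"] \<open>0 < d\<close> by (auto simp: not_le[symmetric])
    then obtain y where y: "\<And>n. y n \<in> I n" "\<And>n. y n \<le> x" "\<And>n. g n x - d < h (y n)"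
      by metis
    have "(\<Sum>n<N. g n x - d) \<le> (\<Sum>n<N. h (y n))"
      using y(3) by (intro sum_mono) (auto intro: less_imp_le)
    also have "\<dots> = h (\<Sum>n<N. y n)"
      by (simp add: h.sum)
    also have "(\<Sum>n<N. y n) \<le> x"
    proof (rule sum_disjoint_le)
      show "0 \<le> y n" for n
        using y(1)[of n] by (simp add: I_def)
      show "inf (y m) (y n) = 0" if "m \<noteq> n" for m n
        using disj[OF y(1) y(1) that] .
    qed (use x y(2) in auto)
    then have "h (\<Sum>n<N. y n) \<le> h x"
      by (rule positive_functional_mono[OF h])
    finally have "(\<Sum>n<N. g n x) \<le> h x + N * d"
      by (simp add: sum_subtractf)
    moreover have "N * d \<le> e"
      using e by (simp add: d_def field_simps)
    ultimately show "(\<Sum>n<N. g n x) \<le> h x + e"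
      by simp
  qed
  have "u n \<in> I n" for n
    using u by (simp add: I_def)
  then show thesis
    using g(2) by (intro that[of g] g(1) sum_le) auto
qed

text \<open>Partial sums of a disjoint sequence below \<open>v\<close> stay below \<open>v\<close>,
  so the values of \<open>f\<close> are summable.\<close>

lemma disjoint_order_bounded_null:
  fixes y :: "nat \<Rightarrow> 'a::banach_lattice"
  assumes f: "positive_functional f" and y: "\<And>n. 0 \<le> y n" "\<And>n. y n \<le> v"
    and disj: "\<And>m n. m \<noteq> n \<Longrightarrow> inf (y m) (y n) = 0"
  shows "(\<lambda>n. f (y n)) \<longlonglongrightarrow> 0"
proof -
  interpret bounded_linear f
    using f by (simp add: positive_functional_def)
  have v: "0 \<le> v"
    using y[of 0] by (rule order_trans)
  have "summable (\<lambda>n. f (y n))"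
  proof (rule summableI_nonneg_bounded)
    show "0 \<le> f (y n)" for n
      using f y by (simp add: positive_functional_def)
    show "(\<Sum>i<n. f (y i)) \<le> f v" for n
      unfolding sum[symmetric] using y v disj
      by (intro positive_functional_mono[OF f] sum_disjoint_le) auto
  qed
  then show ?thesis
    by (rule summable_LIMSEQ_zero)
qed

text \<open>The bound by \<open>h\<close> puts the coefficients \<open>g n x\<close> into the space
  of summable sequences, whose unit vectors are then sent to the \<open>z n\<close>. A positive
  functional is small at \<open>z n\<close> for large \<open>n\<close>, so it nearly annihilates the
  tail of the series, uniformly on the unit ball; the remaining finite sum lies in an order
  interval.\<close>

lemma positive_operator_through_summable:
  fixes g :: "nat \<Rightarrow> 'a::banach_lattice \<Rightarrow> real" and z :: "nat \<Rightarrow> 'b::banach_lattice"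
  assumes h: "positive_functional h" and g: "\<And>n. positive_functional (g n)"
    and sum_le: "\<And>N x. 0 \<le> x \<Longrightarrow> (\<Sum>n<N. g n x) \<le> h x"
    and z: "\<And>n. 0 \<le> z n" "\<And>n. norm (z n) \<le> 1"
    and null: "\<And>f. positive_functional f \<Longrightarrow> (\<lambda>n. f (z n)) \<longlonglongrightarrow> 0"
  obtains T :: "'a \<Rightarrow> 'b" where "positive_operator T" "disjointly_weakly_compact_operator T"
    "\<And>n x. 0 \<le> x \<Longrightarrow> g n x *\<^sub>R z n \<le> T x"
proof -
  define T where "T x = (\<Sum>n. g n x *\<^sub>R z n)" for x
  have lin_g: "linear (g n)" for n
    using g[of n] by (simp add: positive_functional_def bounded_linear.linear)
  have g_nonneg: "0 \<le> g n x" if "0 \<le> x" for n x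
    using g[of n] that by (simp add: positive_functional_def)
  have abs_g: "\<bar>g n x\<bar> \<le> g n \<bar>x\<bar>" for n x
    using positive_functional_mono[OF g abs_ge_self, of n x]
      positive_functional_mono[OF g abs_ge_minus_self, of n x] linear_neg[OF lin_g, of n x]
    by (simp add: abs_le_iff)
  have summ_g: "summable (\<lambda>n. g n x)" and suminf_g: "(\<Sum>n. g n x) \<le> h x" if "0 \<le> x" for x
  proof -
    show s: "summable (\<lambda>n. g n x)"
      using that by (intro summableI_nonneg_bounded[of _ "h x"] g_nonneg sum_le)
    show "(\<Sum>n. g n x) \<le> h x"
      using that by (intro suminf_le_const s sum_le)
  qed
  have norm_le: "norm (g n x *\<^sub>R z n) \<le> g n \<bar>x\<bar>" for n x
    using mult_mono[OF abs_g[of n x] z(2)[of n]] g_nonneg[of "\<bar>x\<bar>" n] by simp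
  have summ: "summable (\<lambda>n. g n x *\<^sub>R z n)" for x
    by (rule summable_comparison_test'[of "\<lambda>n. g n \<bar>x\<bar>" 0]) (simp_all only: norm_le summ_g abs_ge_zero)
  interpret h: bounded_linear h
    using h by (simp add: positive_functional_def)
  obtain K where K: "0 < K" "\<And>x. norm (h x) \<le> norm x * K"
    using h.pos_bounded by blast
  have h_le: "h \<bar>x\<bar> \<le> norm x * K" for x
    using K(2)[of "\<bar>x\<bar>"] by (simp add: norm_abs)
  have bl: "bounded_linear T"
  proof (rule bounded_linear_intro[where K = K])
    show "T (x + y) = T x + T y" for x y
      unfolding T_def by (simp add: suminf_add[OF summ summ] linear_add[OF lin_g] scaleR_add_left)
    show "T (c *\<^sub>R x) = c *\<^sub>R T x" for c x
      unfolding T_def using suminf_scaleR_right[OF summ, of c x] by (simp add: linear_scale[OF lin_g])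
    show "norm (T x) \<le> norm x * K" for x
    proof -
      have "norm (T x) \<le> (\<Sum>n. g n \<bar>x\<bar>)"
        unfolding T_def by (rule norm_suminf_le[OF norm_le summ_g]) simp
      then show ?thesis
        using suminf_g[of "\<bar>x\<bar>"] h_le[of x] by simp
    qed
  qed
  \<comment> \<open>Used with the empty set for positivity of \<open>T\<close>, with initial
    segments for splitting off the tail, and with singletons for the domination claimed.\<close>
  have le_T: "(\<Sum>n\<in>I. g n x *\<^sub>R z n) \<le> T x" if "0 \<le> x" "finite I" for x I
    unfolding T_def using that by (intro le_suminf_banach_lattice summ scaleR_nonneg_nonneg g_nonneg z)
  have pos: "positive_operator T"
    using bl le_T[of _ "{}"] by (simp add: positive_operator_def bounded_linear.linear)
  have abs_T: "\<bar>T x\<bar> \<le> T \<bar>x\<bar>" for x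
  proof (rule abs_leI)
    interpret bounded_linear T by (rule bl)
    have "0 \<le> T (\<bar>x\<bar> - x)" "0 \<le> T (\<bar>x\<bar> - (- x))"
      using pos abs_ge_self[of x] abs_ge_minus_self[of x] unfolding positive_operator_def
      by (simp_all only: diff_ge_0_iff_ge)
    then show "T x \<le> T \<bar>x\<bar>" "- T x \<le> T \<bar>x\<bar>"
      by (simp_all only: diff neg diff_ge_0_iff_ge)
  qed
  have tail: "f (T x - (\<Sum>n<N. g n x *\<^sub>R z n)) \<le> e * h x"
    if f: "positive_functional f" and "0 \<le> x" and e: "\<And>n. N \<le> n \<Longrightarrow> f (z n) \<le> e" for f N e x
  proof -
    interpret f: bounded_linear f
      using f by (simp add: positive_functional_def)
    have "0 \<le> e"
      using e[of N] f z(1)[of N] by (auto simp: positive_functional_def intro: order_trans)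
    note sg = summ_g[OF \<open>0 \<le> x\<close>]
    have "T x - (\<Sum>n<N. g n x *\<^sub>R z n) = (\<Sum>n. g (n + N) x *\<^sub>R z (n + N))"
      unfolding T_def using suminf_split_initial_segment[OF summ[of x], of N] by simp
    then have "f (T x - (\<Sum>n<N. g n x *\<^sub>R z n)) = (\<Sum>n. f (g (n + N) x *\<^sub>R z (n + N)))"
      using f.suminf[OF summable_ignore_initial_segment[OF summ[of x], of N]] by simp
    also have "\<dots> \<le> (\<Sum>n. e * g (n + N) x)"
    proof (rule suminf_le)
      show "f (g (n + N) x *\<^sub>R z (n + N)) \<le> e * g (n + N) x" for n
        using mult_left_mono[OF e[of "n + N"] g_nonneg[OF \<open>0 \<le> x\<close>, of "n + N"]]
        by (simp add: f.scaleR mult.commute)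
      show "summable (\<lambda>n. f (g (n + N) x *\<^sub>R z (n + N)))"
        by (rule f.summable[OF summable_ignore_initial_segment[OF summ]])
      show "summable (\<lambda>n. e * g (n + N) x)"
        by (rule summable_mult[OF summable_ignore_initial_segment[OF sg]])
    qed
    also have "\<dots> = e * (\<Sum>n. g (n + N) x)"
      by (rule suminf_mult[OF summable_ignore_initial_segment[OF sg]])
    also have "(\<Sum>n. g (n + N) x) \<le> (\<Sum>n. g n x)"
      using suminf_split_initial_segment[OF sg, of N] g_nonneg[OF \<open>0 \<le> x\<close>]
      by (simp add: sum_nonneg)
    then have "e * (\<Sum>n. g (n + N) x) \<le> e * h x"
      using suminf_g[OF \<open>0 \<le> x\<close>] \<open>0 \<le> e\<close> by (intro mult_left_mono) auto
    finally show ?thesis .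
  qed
  have null_hull: "weakly_null y" if y: "disjoint_seq y" "range y \<subseteq> solid_hull (T ` cball 0 1)" for y
  proof (rule weakly_null_iff_positive(2), unfold weakly_null_iff_positive(1), intro allI impI)
    fix f :: "'b \<Rightarrow> real" assume f: "positive_functional f"
    interpret f: bounded_linear f
      using f by (simp add: positive_functional_def)
    have "y k \<in> solid_hull (T ` cball 0 1)" for k
      using y(2) by blast
    then have "\<forall>k. \<exists>b. norm b \<le> 1 \<and> \<bar>y k\<bar> \<le> \<bar>T b\<bar>"
      by (fastforce simp: solid_hull_def)
    then obtain b where b: "\<And>k. norm (b k) \<le> 1" "\<And>k. \<bar>y k\<bar> \<le> \<bar>T (b k)\<bar>"
      by metis
    have hb: "h \<bar>b k\<bar> \<le> K" for k
    proof -
      have "norm (b k) * K \<le> 1 * K"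
        using b(1) K(1) by (intro mult_right_mono) auto
      then show ?thesis
        using h_le[of "b k"] by linarith
    qed
    show "(\<lambda>k. f \<bar>y k\<bar>) \<longlonglongrightarrow> 0"
    proof (rule LIMSEQ_I)
      fix e :: real assume e: "0 < e"
      \<comment> \<open>Since \<open>h\<close> is at most \<open>K\<close> at moduli of elements of
        the unit ball, tails have \<open>f\<close>-value at most
        \<open>d * K = e / 2\<close>.\<close>
      define d where "d = e / (2 * K)"
      have "0 < d"
        using e K by (simp add: d_def)
      then have "eventually (\<lambda>n. f (z n) < d) sequentially"
        using order_tendstoD(2)[OF null[OF f]] by blast
      then obtain N where N: "\<And>n. N \<le> n \<Longrightarrow> f (z n) < d"
        unfolding eventually_sequentially by blast
      \<comment> \<open>All coefficients \<open>g n \<bar>b k\<bar>\<close> are at most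
        \<open>K\<close>, so \<open>v\<close> bounds the initial sums for every \<open>k\<close>
        simultaneously.\<close>
      define v where "v = (\<Sum>n<N. K *\<^sub>R z n)"
      have v: "0 \<le> v"
        unfolding v_def using K z by (intro sum_nonneg scaleR_nonneg_nonneg) auto
      have "(\<lambda>k. f (inf \<bar>y k\<bar> v)) \<longlonglongrightarrow> 0"
      proof (rule disjoint_order_bounded_null[OF f, where v = v])
        show "inf (inf \<bar>y m\<bar> v) (inf \<bar>y n\<bar> v) = 0" if "m \<noteq> n" for m n
        proof (rule antisym)
          have "inf (inf \<bar>y m\<bar> v) (inf \<bar>y n\<bar> v) \<le> inf \<bar>y m\<bar> \<bar>y n\<bar>"
            by (intro inf_mono) auto
          also have "\<dots> = 0"
            using y(1) that by (simp add: disjoint_seq_def)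
          finally show "inf (inf \<bar>y m\<bar> v) (inf \<bar>y n\<bar> v) \<le> 0" .
        qed (use v in simp)
      qed (use v in auto)
      then have "eventually (\<lambda>k. f (inf \<bar>y k\<bar> v) < e / 2) sequentially"
        by (rule order_tendstoD) (use e in simp)
      then obtain M where M: "\<And>k. M \<le> k \<Longrightarrow> f (inf \<bar>y k\<bar> v) < e / 2"
        unfolding eventually_sequentially by blast
      have "norm (f \<bar>y k\<bar> - 0) < e" if "M \<le> k" for k
      proof -
        define r where "r = T \<bar>b k\<bar> - (\<Sum>n<N. g n \<bar>b k\<bar> *\<^sub>R z n)"
        have "0 \<le> r"
          unfolding r_def using le_T[of "\<bar>b k\<bar>" "{..<N}"] by simp
        have "g n \<bar>b k\<bar> \<le> K" for n
        proof -
          have "g n \<bar>b k\<bar> \<le> (\<Sum>i<Suc n. g i \<bar>b k\<bar>)"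
            using g_nonneg[of "\<bar>b k\<bar>"] by (simp add: sum_nonneg)
          then show ?thesis
            using sum_le[of "\<bar>b k\<bar>" "Suc n"] hb[of k] by simp
        qed
        then have "(\<Sum>n<N. g n \<bar>b k\<bar> *\<^sub>R z n) \<le> v"
          unfolding v_def using z by (intro sum_mono scaleR_right_mono)
        then have "T \<bar>b k\<bar> \<le> v + r"
          by (simp add: r_def)
        moreover have "\<bar>y k\<bar> \<le> T \<bar>b k\<bar>"
          using b(2)[of k] abs_T[of "b k"] by (rule order_trans)
        \<comment> \<open>What exceeds \<open>v\<close> is absorbed by the tail \<open>r\<close>;
          the truncations of \<open>\<bar>y k\<bar>\<close> by \<open>v\<close> are disjoint and
          order bounded, hence null under \<open>f\<close>.\<close>
        ultimately have "\<bar>y k\<bar> - v \<le> r"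
          by (simp add: diff_le_eq add.commute)
        then have "pprt (\<bar>y k\<bar> - v) \<le> r"
          using \<open>0 \<le> r\<close> by (rule pprt_least)
        then have "\<bar>y k\<bar> \<le> inf \<bar>y k\<bar> v + r"
          unfolding pprt_diff_inf by (simp only: diff_le_eq add.commute)
        then have "f \<bar>y k\<bar> \<le> f (inf \<bar>y k\<bar> v) + f r"
          using positive_functional_mono[OF f] by (simp only: f.add[symmetric])
        also have "f r \<le> d * h \<bar>b k\<bar>"
          unfolding r_def using N by (intro tail f) (auto intro: less_imp_le)
        also have "d * h \<bar>b k\<bar> \<le> d * K"
          using hb \<open>0 < d\<close> by (intro mult_left_mono) auto
        also have "d * K = e / 2"
          using K(1) by (simp add: d_def)
        finally have "f \<bar>y k\<bar> < e"
          using M[OF that] by simp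
        moreover have "0 \<le> f \<bar>y k\<bar>"
          using f by (simp add: positive_functional_def)
        ultimately show ?thesis
          by simp
      qed
      then show "\<exists>M. \<forall>k\<ge>M. norm (f \<bar>y k\<bar> - 0) < e"
        by blast
    qed
  qed
  show thesis
  proof (rule that[OF pos])
    show "disjointly_weakly_compact_operator T"
      using bl null_hull bounded_linear_image[OF bounded_cball bl]
      by (simp add: disjointly_weakly_compact_operator_def disjointly_weakly_compact_set_def)
    show "g n x *\<^sub>R z n \<le> T x" if "0 \<le> x" for n x
      using le_T[of x "{n}"] that by simp
  qed
qed

subsection \<open>The positive Schur property\<close>

text \<open>The property concerns positive sequences, so it is applied to the moduli, which are
  again disjoint and in the solid hull and have the same norms.\<close>

lemma positive_schur_imp_L_weakly_compact:
  fixes T :: "'x::banach \<Rightarrow> 'e::banach_lattice"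
  assumes psp: "positive_schur_property TYPE('e)" and T: "disjointly_weakly_compact_operator T"
  shows "L_weakly_compact_operator T"
proof -
  let ?A = "T ` cball 0 1"
  have "x \<longlonglongrightarrow> 0" if x: "disjoint_seq x" "range x \<subseteq> solid_hull ?A" for x
  proof -
    have "\<bar>x n\<bar> \<in> solid_hull ?A" for n
    proof -
      have "x n \<in> solid_hull ?A"
        using x(2) by blast
      then show ?thesis
        by (simp add: solid_hull_def)
    qed
    then have "disjoint_seq (\<lambda>n. \<bar>x n\<bar>)" "range (\<lambda>n. \<bar>x n\<bar>) \<subseteq> solid_hull ?A"
      using x(1) by (auto simp: disjoint_seq_def)
    then have "weakly_null (\<lambda>n. \<bar>x n\<bar>)"
      using T by (auto simp: disjointly_weakly_compact_operator_def disjointly_weakly_compact_set_def)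
    then have "(\<lambda>n. \<bar>x n\<bar>) \<longlonglongrightarrow> 0"
      using psp by (auto simp: positive_schur_property_def)
    then have "(\<lambda>n. norm (x n)) \<longlonglongrightarrow> 0"
      using tendsto_norm_zero by (fastforce simp: norm_abs)
    then show ?thesis
      by (rule tendsto_norm_zero_cancel)
  qed
  then show ?thesis
    using T by (simp add: L_weakly_compact_operator_def L_weakly_compact_set_def
        disjointly_weakly_compact_operator_def disjointly_weakly_compact_set_def)
qed

lemma disjointly_weakly_compact_operator_onto:
  fixes w :: "nat \<Rightarrow> 'e::banach_lattice"
  assumes w: "\<And>n. 0 \<le> w n" "\<And>n. norm (w n) \<le> 1"
    and null: "\<And>f. positive_functional f \<Longrightarrow> (\<lambda>n. f (w n)) \<longlonglongrightarrow> 0"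
  obtains T :: "'e \<Rightarrow> 'e" and c where "positive_operator T" "disjointly_weakly_compact_operator T"
    "0 < c" "\<And>n. \<exists>b\<in>cball 0 1. c *\<^sub>R w n \<le> T b"
proof (cases "\<forall>x :: nat \<Rightarrow> 'e. disjoint_seq x \<and> (\<forall>n. norm (x n) \<le> 1) \<longrightarrow> weakly_null x")
  case True
  show thesis
  proof (rule that[of id 1])
    show "positive_operator (id :: 'e \<Rightarrow> 'e)"
      by (simp add: positive_operator_def linear_id)
    have "weakly_null x" if x: "disjoint_seq x" "range x \<subseteq> solid_hull (cball 0 1)" for x :: "nat \<Rightarrow> 'e"
    proof -
      have "norm (x n) \<le> 1" for n
      proof -
        obtain b where "norm b \<le> 1" "\<bar>x n\<bar> \<le> \<bar>b\<bar>"
          using x(2) by (fastforce simp: solid_hull_def)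
        then show ?thesis
          using norm_mono_abs[of "x n" b] by simp
      qed
      then show ?thesis
        using True x(1) by blast
    qed
    then show "disjointly_weakly_compact_operator (id :: 'e \<Rightarrow> 'e)"
      by (simp add: disjointly_weakly_compact_operator_def disjointly_weakly_compact_set_def
          bounded_linear_ident[folded id_def])
    show "\<exists>b\<in>cball 0 1. 1 *\<^sub>R w n \<le> id b" for n
      using w by (intro bexI[of _ "w n"]) auto
  qed simp
next
  case False
  then obtain x :: "nat \<Rightarrow> 'e" where x: "disjoint_seq x" "\<And>n. norm (x n) \<le> 1" "\<not> weakly_null x"
    by blast
  then obtain h where h: "positive_functional h" "\<not> (\<lambda>n. h \<bar>x n\<bar>) \<longlonglongrightarrow> 0"
    using weakly_null_iff_positive by blast
  obtain r :: "nat \<Rightarrow> nat" and e where r: "strict_mono r" "0 < e" "\<And>n. e \<le> norm (h \<bar>x (r n)\<bar>)"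
    using not_LIMSEQ_zero_subseq[OF h(2)] by blast
  define u where "u n = \<bar>x (r n)\<bar>" for n
  have u: "0 \<le> u n" "norm (u n) \<le> 1" "e \<le> h (u n)" for n
    using x(2)[of "r n"] r(3)[of n] h(1) by (auto simp: u_def norm_abs positive_functional_def)
  have "inf (u m) (u n) = 0" if "m \<noteq> n" for m n
    using x(1) that strict_mono_eq[OF r(1), of m n] by (simp add: disjoint_seq_def u_def)
  then obtain g where g: "\<And>n. positive_functional (g n)" "\<And>n. h (u n) \<le> g n (u n)"
    "\<And>N x. 0 \<le> x \<Longrightarrow> (\<Sum>n<N. g n x) \<le> h x"
    using band_components[of h u] h(1) u(1) by blast
  obtain T :: "'e \<Rightarrow> 'e" where T: "positive_operator T" "disjointly_weakly_compact_operator T"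
    "\<And>n x. 0 \<le> x \<Longrightarrow> g n x *\<^sub>R w n \<le> T x"
    using positive_operator_through_summable[of h g w] h(1) g(1,3) w null by blast
  \<comment> \<open>The witness is \<open>u n\<close>: its coefficient satisfies
    \<open>e <= h (u n) <= g n (u n)\<close>, because the component of \<open>h\<close> loses
    nothing at \<open>u n\<close>.\<close>
  have "\<exists>b\<in>cball 0 1. e *\<^sub>R w n \<le> T b" for n
  proof (rule bexI)
    have "e *\<^sub>R w n \<le> g n (u n) *\<^sub>R w n"
      using u(3)[of n] g(2)[of n] w(1) by (intro scaleR_right_mono) auto
    then show "e *\<^sub>R w n \<le> T (u n)"
      using T(3)[OF u(1), of n n] by (rule order_trans)
  qed (use u in simp)
  then show thesis
    using that T(1,2) r(2) by blast
qed

text \<open>Dividing by \<open>max 1 (norm (z n))\<close> keeps \<open>w n\<close> below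
  \<open>z n\<close>, so nullity against positive functionals survives without any bound on the
  norms of \<open>z\<close>. It changes only terms of norm above 1, and those become unit vectors,
  so a norm null \<open>w\<close> would eventually coincide with \<open>z\<close>.\<close>

lemma weakly_null_normalize:
  fixes z :: "nat \<Rightarrow> 'a::banach_lattice"
  assumes z: "\<And>n. 0 \<le> z n" "weakly_null z" "\<not> z \<longlonglongrightarrow> 0"
  obtains w :: "nat \<Rightarrow> 'a" where "\<And>n. 0 \<le> w n" "\<And>n. norm (w n) \<le> 1" "\<not> w \<longlonglongrightarrow> 0"
    "\<And>f. positive_functional f \<Longrightarrow> (\<lambda>n. f (w n)) \<longlonglongrightarrow> 0"
proof -
  define m where "m n = max 1 (norm (z n))" for n
  define w where "w n = inverse (m n) *\<^sub>R z n" for n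
  have m: "1 \<le> m n" "norm (z n) \<le> m n" for n
    by (auto simp: m_def)
  have w0: "0 \<le> w n" for n
    unfolding w_def using z(1) m(1)[of n] by (intro scaleR_nonneg_nonneg) auto
  have norm_w: "norm (w n) = norm (z n) / m n" for n
    using m(1)[of n] by (simp add: w_def field_simps)
  have "\<not> w \<longlonglongrightarrow> 0"
  proof
    assume lim: "w \<longlonglongrightarrow> 0"
    have "eventually (\<lambda>n. norm (w n) < 1) sequentially"
      using order_tendstoD(2)[OF tendsto_norm_zero[OF lim], of 1] by simp
    then have "eventually (\<lambda>n. w n = z n) sequentially"
    proof eventually_elim
      case (elim n)
      then have "norm (z n) < m n"
        using m(1)[of n] by (simp add: norm_w field_simps)
      then show ?case
        by (auto simp: w_def m_def split: if_splits)
    qed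
    then have "z \<longlonglongrightarrow> 0"
      using lim tendsto_cong by blast
    then show False
      using z(3) by simp
  qed
  moreover have "(\<lambda>n. f (w n)) \<longlonglongrightarrow> 0" if f: "positive_functional f" for f :: "'a \<Rightarrow> real"
  proof (rule tendsto_sandwich[of "\<lambda>_. 0"])
    show "(\<lambda>n. f (z n)) \<longlonglongrightarrow> 0"
      using z(2) f by (simp add: weakly_null_def positive_functional_def)
    have "w n \<le> z n" for n
      using scaleR_right_mono[of "inverse (m n)" 1 "z n"] m(1)[of n] z(1)
      by (simp add: w_def field_simps)
    then show "eventually (\<lambda>n. f (w n) \<le> f (z n)) sequentially"
      by (simp add: positive_functional_mono[OF f])
    show "eventually (\<lambda>n. 0 \<le> f (w n)) sequentially"
      using f w0 by (simp add: positive_functional_def)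
  qed simp
  moreover have "norm (w n) \<le> 1" for n
    using m[of n] by (simp add: norm_w)
  ultimately show thesis
    using that w0 by blast
qed

theorem theorem3p17:
  shows "positive_schur_property TYPE('e::banach_lattice) \<longleftrightarrow>
    (\<forall>T :: 'e \<Rightarrow> 'e. positive_operator T \<and> disjointly_weakly_compact_operator T
       \<longrightarrow> L_weakly_compact_operator T)"
proof
  assume "positive_schur_property TYPE('e)"
  then show "\<forall>T :: 'e \<Rightarrow> 'e. positive_operator T \<and> disjointly_weakly_compact_operator T
       \<longrightarrow> L_weakly_compact_operator T"
    using positive_schur_imp_L_weakly_compact by blast
next
  assume L: "\<forall>T :: 'e \<Rightarrow> 'e. positive_operator T \<and> disjointly_weakly_compact_operator T
       \<longrightarrow> L_weakly_compact_operator T"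
  show "positive_schur_property TYPE('e)"
    unfolding positive_schur_property_def
  proof (intro allI impI, rule ccontr)
    fix z :: "nat \<Rightarrow> 'e" assume z: "(\<forall>n. 0 \<le> z n) \<and> weakly_null z" and "\<not> z \<longlonglongrightarrow> 0"
    obtain w :: "nat \<Rightarrow> 'e" where w: "\<And>n. 0 \<le> w n" "\<And>n. norm (w n) \<le> 1" "\<not> w \<longlonglongrightarrow> 0"
      "\<And>f. positive_functional f \<Longrightarrow> (\<lambda>n. f (w n)) \<longlonglongrightarrow> 0"
      using weakly_null_normalize[of z] z \<open>\<not> z \<longlonglongrightarrow> 0\<close> by blast
    obtain y :: "nat \<Rightarrow> 'e" where y: "\<And>i. 0 \<le> y i" "\<And>i. \<exists>n. y i \<le> w n"
      "\<And>i j. i \<noteq> j \<Longrightarrow> inf (y i) (y j) = 0" "\<not> y \<longlonglongrightarrow> 0"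
      using disjoint_below_weakly_null[of w] w by blast
    obtain T :: "'e \<Rightarrow> 'e" and c where T: "positive_operator T" "disjointly_weakly_compact_operator T"
      and c: "0 < c" "\<And>n. \<exists>b\<in>cball 0 1. c *\<^sub>R w n \<le> T b"
      using disjointly_weakly_compact_operator_onto[of w] w(1,2,4) by blast
    have cy: "0 \<le> c *\<^sub>R y i" for i
      using c(1) y(1) by (intro scaleR_nonneg_nonneg) auto
    \<comment> \<open>The factor \<open>c\<close> brings \<open>y\<close> into the solid hull of the
      image of the unit ball, since each \<open>y i\<close> lies below some
      \<open>w n\<close>.\<close>
    have "disjoint_seq (\<lambda>i. c *\<^sub>R y i)"
      unfolding disjoint_seq_def abs_of_nonneg[OF cy] using c(1) y(3) by (simp add: inf_scaleR)
    moreover have "c *\<^sub>R y i \<in> solid_hull (T ` cball 0 1)" for i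
    proof -
      obtain n where "y i \<le> w n"
        using y(2) by blast
      then have "c *\<^sub>R y i \<le> c *\<^sub>R w n"
        using c(1) by (intro scaleR_left_mono) auto
      moreover obtain b where b: "b \<in> cball 0 1" "c *\<^sub>R w n \<le> T b"
        using c(2) by blast
      ultimately have "\<bar>c *\<^sub>R y i\<bar> \<le> \<bar>T b\<bar>"
        unfolding abs_of_nonneg[OF cy] by (meson abs_ge_self order_trans)
      then show ?thesis
        using b(1) unfolding solid_hull_def by blast
    qed
    ultimately have "(\<lambda>i. c *\<^sub>R y i) \<longlonglongrightarrow> 0"
      using L T by (auto simp: L_weakly_compact_operator_def L_weakly_compact_set_def)
    then have "(\<lambda>i. inverse c *\<^sub>R c *\<^sub>R y i) \<longlonglongrightarrow> inverse c *\<^sub>R 0"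
      by (rule tendsto_scaleR[OF tendsto_const])
    then show False
      using c(1) y(4) by simp
  qed
qed

end
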